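(* Let $M_n$ be a sequence of integers such that, setting $m(n)=2^n/M_n$, $$ n\log n\ll m(n)\le 2^n. $$ Let $A_n$ be subsets of $M_n$ elements sampled from $\mathcal V_n$ without replacement (i.e. each subset of $\mathcal V_n$ with $M_n$ elements is equally likely), and defined on a common probability space $(\Omega',F',P')$. Then, for all $a>0$, $$\lim_{n\to\infty}\max_{x\in\mathcal V_n}\Big|\mathbb P_x\big[H_n(A_n\setminus x)\ge a\,m(n)\big]-e^{-a}\Big|=0,\qquad P'\text{-a.s.}$$
   Context: $\mathcal V_n=\{0,1\}^n$ is the $n$-dimensional hypercube with metric $d(x,y)=\sum_{i=1}^n \mathbf 1\{x(i)\ne y(i)\}$. $Y_n$ is the discrete-time simple random walk on $\mathcal V_n$: it has transition probabilities $\mathbb P[Y_n(k+1)=y\mid Y_n(k)=x]=n^{-1}$ if $d(x,y)=1$ and $0$ otherwise; $\mathbb P_x$ is its law conditioned on $Y_n(0)=x$, for a fixed realisation of the random sets $A_n$. For $A\subset\mathcal V_n$, the hitting time is $H_n(A)=\min\{k\ge 0: Y_n(k)\in A\}$. $A\setminus x$ means $A\setminus\{x\}$. For positive sequences, $u(n)\ll v(n)$ means $u(n)/v(n)\to0$ as $n\to\infty$.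
   Formalization: The limit with the maximum over all x is proved when M_n tends to infinity, and without that condition for the maximum over x outside A_n; as written the claim fails for bounded M_n (for M_n=1 and x in A_n, the set A_n\x is empty and the probability is 1). *)

theory Defs
  imports "HOL-Probability.Probability"
begin

text \<open>Vertices are \<open>0\<close>-\<open>1\<close>-valued functions on \<open>{1..n}\<close>, extended by \<open>undefined\<close>, so that all the
  hypercubes live in one type.\<close>

type_synonym vertex = "nat \<Rightarrow> nat"

definition hypercube :: "nat \<Rightarrow> vertex set" where
  "hypercube n = {1..n} \<rightarrow>\<^sub>E {0, 1}"

definition hdist :: "nat \<Rightarrow> vertex \<Rightarrow> vertex \<Rightarrow> nat" where
  "hdist n x y = (\<Sum>i = 1..n. of_bool (x i \<noteq> y i))"

definition srw_step :: "nat \<Rightarrow> vertex \<Rightarrow> vertex \<Rightarrow> real" where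
  "srw_step n x y = (if hdist n x y = 1 then 1 / real n else 0)"

text \<open>\<open>simple_random_walk n x P Y\<close>: under \<open>P\<close>, the process \<open>Y\<close> is a Markov chain started in \<open>x\<close> with
  transition probabilities \<open>srw_step n\<close>. The conditioning is on the whole past, so this
  includes the Markov property.\<close>

definition simple_random_walk ::
    "nat \<Rightarrow> vertex \<Rightarrow> 'w measure \<Rightarrow> (nat \<Rightarrow> 'w \<Rightarrow> vertex) \<Rightarrow> bool" where
  "simple_random_walk n x P Y \<longleftrightarrow>
     prob_space P \<and>
     (\<forall>k. Y k \<in> measurable P (count_space (hypercube n))) \<and>
     (AE w in P. Y 0 w = x) \<and>
     (\<forall>k ys. \<forall>y\<in>hypercube n.
        \<P>(w in P. \<forall>j\<le>k. Y j w = ys j) > 0 \<longrightarrow>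
        \<P>(w in P. Y (Suc k) w = y \<bar> \<forall>j\<le>k. Y j w = ys j) = srw_step n (ys k) y)"

definition hitting_time :: "'s set \<Rightarrow> (nat \<Rightarrow> 's) \<Rightarrow> enat" where
  "hitting_time B y = Inf {enat k |k. y k \<in> B}"

definition k_subsets :: "'s set \<Rightarrow> nat \<Rightarrow> 's set set" where
  "k_subsets V k = {B. B \<subseteq> V \<and> card B = k}"

text \<open>The empty set is never hit. Hence for \<open>M n = 1\<close> and \<open>x \<in> A n\<close> the event
  \<open>hitting_time (A n - {x}) \<ge> a * m n\<close> has probability \<open>1\<close> and not about \<open>exp (- a)\<close>. More
  generally, for \<open>x \<in> A n\<close> only \<open>M n - 1\<close> points are left to be hit, and the limit along a
  bounded value \<open>M n = j\<close> is \<open>exp (- a * (j - 1) / j)\<close>. So the maximum may run over all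
  starting points only if \<open>M n\<close> tends to infinity; over the starting points outside
  \<open>A n\<close> no such restriction is needed.\<close>

lemma hitting_time_empty [simp]: "hitting_time {} y = \<infinity>"
  by (simp add: hitting_time_def top_enat_def)

end

theory Submission
  imports Defs "HOL-Real_Asymp.Real_Asymp"
begin

text \<open>The reason for the exponential law is that time splits into blocks that are long compared with the
mixing time \<open>n ln n\<close> and short compared with \<open>m n\<close>. At the end of a block the walk has almost
forgotten where it was, so survival of many blocks is close to a product; each factor differs from
\<open>1\<close> by about (block length) / \<open>m n\<close>, and there are about \<open>a * m n\<close> / (block length) factors.

Let \<open>B\<close> be the set to be avoided and \<open>b\<close> its density in the cube. A block has length
\<open>t + 2 * r\<close>, with \<open>t\<close> just above \<open>n ln n\<close>, and \<open>t << r << m n\<close>. After time \<open>t\<close> the law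
of the walk, averaged over two consecutive times, is uniform up to a factor \<open>1 + O(1/n)\<close>
(\<open>transition_two_steps_near_uniform\<close>); the average over two times removes the parity obstruction.
Hence the expected number of visits to \<open>B\<close> during the last \<open>2 * r\<close> steps of a block is
\<open>2 * r * b * (1 + O(1/n))\<close> from every starting point.

The expected number of visits bounds the probability of a visit from above. It is also nearly a
lower bound as soon as visits do not come in clusters: if from every vertex the expected number of
visits to \<open>B\<close> within one block is at most \<open>\<epsilon>\<close>, then the probability of a visit is at least
\<open>1 - \<epsilon>\<close> times the expectation (\<open>one_minus_survival_ge_mean_hits\<close>). The same bound by \<open>\<epsilon>\<close>
controls the first \<open>t\<close> steps of the walk, in which it still remembers its starting point. The
first \<open>t\<close> steps of all later blocks together contribute only about \<open>a * t / r\<close> expected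
visits. This gives two-sided bounds for the survival probability (\<open>survival_blocks_le\<close>,
\<open>survival_blocks_ge\<close>).

So everything about the random set \<open>A n\<close> is contained in one property: the expected number of
visits to \<open>A n\<close> within one block tends to \<open>0\<close> uniformly in the starting point
(\<open>AE_mean_hits_small\<close>). For a fixed starting point this number is a sum over \<open>y \<in> A n\<close> of
weights with total mass \<open>t + 2 * r\<close>, so that its mean is about (block length) / \<open>m n\<close>, and
each weight is \<open>O(1/n)\<close>. The bound on the weights comes from the estimates \<open>p_k <= 1/n\<close> of the
\<open>k\<close>-step transition probabilities for the first few steps and from \<open>p_k = O(1/n^3)\<close> for the
others, the block length being \<open>O(n^2)\<close>. A Chernoff bound with parameter of order \<open>n\<close> then gives a
failure probability at most \<open>exp (- 2 * n)\<close>, which survives a union bound over \<open>2 ^ n\<close>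
starting points and is summable; the Borel-Cantelli lemma concludes.\<close>

section \<open>Averaging over neighbours and the transition kernel\<close>

definition flip :: "vertex \<Rightarrow> nat \<Rightarrow> vertex" where
  "flip x i = x(i := 1 - x i)"

definition neighbour_avg :: "nat \<Rightarrow> (vertex \<Rightarrow> real) \<Rightarrow> vertex \<Rightarrow> real" where
  "neighbour_avg n f x = (\<Sum>i = 1..n. f (flip x i)) / real n"

primrec transition :: "nat \<Rightarrow> nat \<Rightarrow> vertex \<Rightarrow> vertex \<Rightarrow> real" where
  "transition n 0 x y = of_bool (x = y)"
| "transition n (Suc k) x y = neighbour_avg n (\<lambda>z. transition n k z y) x"

lemma finite_hypercube [simp]: "finite (hypercube n)"
  unfolding hypercube_def by (intro finite_PiE) auto

lemma card_hypercube: "card (hypercube n) = 2 ^ n"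
  unfolding hypercube_def by (subst card_PiE) (auto simp: numeral_2_eq_2)

lemma flip_in_hypercube: "x \<in> hypercube n \<Longrightarrow> i \<in> {1..n} \<Longrightarrow> flip x i \<in> hypercube n"
  unfolding hypercube_def flip_def by (auto simp: PiE_iff extensional_def)

lemma neighbour_avg_mono:
  assumes "x \<in> hypercube n" "\<And>y. y \<in> hypercube n \<Longrightarrow> f y \<le> g y"
  shows "neighbour_avg n f x \<le> neighbour_avg n g x"
  unfolding neighbour_avg_def using assms
  by (intro divide_right_mono sum_mono) (simp_all add: flip_in_hypercube)

lemma neighbour_avg_cong:
  assumes "x \<in> hypercube n" "\<And>y. y \<in> hypercube n \<Longrightarrow> f y = g y"
  shows "neighbour_avg n f x = neighbour_avg n g x"
  using neighbour_avg_mono[of x n f g] neighbour_avg_mono[of x n g f] assms by force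

lemma neighbour_avg_const: "n \<ge> 1 \<Longrightarrow> neighbour_avg n (\<lambda>_. c) x = c"
  by (simp add: neighbour_avg_def)

lemma neighbour_avg_diff:
  "neighbour_avg n (\<lambda>y. f y - g y) x = neighbour_avg n f x - neighbour_avg n g x"
  by (simp add: neighbour_avg_def sum_subtractf diff_divide_distrib)

lemma neighbour_avg_cmult: "neighbour_avg n (\<lambda>y. c * f y) x = c * neighbour_avg n f x"
  by (simp add: neighbour_avg_def sum_distrib_left)

lemma neighbour_avg_sum:
  "neighbour_avg n (\<lambda>y. \<Sum>j\<in>J. f j y) x = (\<Sum>j\<in>J. neighbour_avg n (f j) x)"
  unfolding neighbour_avg_def sum_divide_distrib[symmetric] by (simp add: sum.swap[of _ J])

lemma neighbour_avg_nonneg: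
  assumes "x \<in> hypercube n" "\<And>y. y \<in> hypercube n \<Longrightarrow> 0 \<le> f y"
  shows "0 \<le> neighbour_avg n f x"
  using neighbour_avg_mono[OF assms(1), of "\<lambda>_. 0" f] assms(2) by (simp add: neighbour_avg_def)

lemma neighbour_avg_le:
  assumes "n \<ge> 1" "x \<in> hypercube n" "\<And>y. y \<in> hypercube n \<Longrightarrow> f y \<le> c"
  shows "neighbour_avg n f x \<le> c"
  using neighbour_avg_mono[OF assms(2), of f "\<lambda>_. c"] assms by (simp add: neighbour_avg_const)

lemma inj_on_flip: "x \<in> hypercube n \<Longrightarrow> inj_on (flip x) {1..n}"
proof (rule inj_onI)
  fix i j assume x: "x \<in> hypercube n" and ij: "i \<in> {1..n}" "j \<in> {1..n}" "flip x i = flip x j"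
  have "x i \<in> {0, 1}" using x ij by (auto simp: hypercube_def PiE_iff)
  then have "flip x i i \<noteq> x i" by (auto simp: flip_def)
  then have "flip x j i \<noteq> x i" using ij by simp
  then show "i = j" by (auto simp: flip_def split: if_splits)
qed

text \<open>Links the distance used in the step probabilities to explicit coordinate flips, so that
one step of the walk becomes an average over the \<open>n\<close> coordinates.\<close>

lemma neighbours_eq_flips:
  assumes x: "x \<in> hypercube n"
  shows "{y \<in> hypercube n. hdist n x y = 1} = flip x ` {1..n}"
proof (intro equalityI subsetI)
  fix y assume "y \<in> {y \<in> hypercube n. hdist n x y = 1}"
  then have y: "y \<in> hypercube n" and "card {i \<in> {1..n}. x i \<noteq> y i} = 1"
    by (auto simp: hdist_def of_bool_def sum.If_cases Int_def)
  then obtain i where i: "{i \<in> {1..n}. x i \<noteq> y i} = {i}" by (auto simp: card_1_singleton_iff)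
  then have iy: "i \<in> {1..n}" "x i \<noteq> y i" and o: "\<And>j. j \<in> {1..n} \<Longrightarrow> j \<noteq> i \<Longrightarrow> x j = y j" by auto
  have "y = flip x i"
  proof
    fix j show "y j = flip x i j"
    proof (cases "j \<in> {1..n}")
      case True
      then have "x j \<in> {0, 1}" "y j \<in> {0, 1}" using x y by (auto simp: hypercube_def PiE_iff)
      then show ?thesis using o[OF True] iy by (auto simp: flip_def)
    next
      case False
      then have "x j = undefined" "y j = undefined" "j \<noteq> i" 
        using x y iy by (auto simp: hypercube_def PiE_iff extensional_def simp del: atLeastAtMost_iff)
      then show ?thesis by (simp add: flip_def)
    qed
  qed
  then show "y \<in> flip x ` {1..n}" using iy by auto
next
  fix y assume "y \<in> flip x ` {1..n}"
  then obtain i where i: "i \<in> {1..n}" "y = flip x i" by auto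
  have "x i \<in> {0, 1}" using x i by (auto simp: hypercube_def PiE_iff)
  then have "{j \<in> {1..n}. x j \<noteq> y j} = {i}" using i by (auto simp: flip_def)
  then have "hdist n x y = 1" by (simp add: hdist_def of_bool_def sum.If_cases Int_def)
  then show "y \<in> {y \<in> hypercube n. hdist n x y = 1}" using flip_in_hypercube[OF x i(1)] i by auto
qed

lemma sum_srw_step:
  assumes "x \<in> hypercube n"
  shows "(\<Sum>y\<in>hypercube n. srw_step n x y * f y) = neighbour_avg n f x"
proof -
  have "(\<Sum>y\<in>hypercube n. srw_step n x y * f y) =
      (\<Sum>y\<in>{y \<in> hypercube n. hdist n x y = 1}. f y / real n)"
    by (simp add: srw_step_def if_distrib if_distribR sum.inter_filter cong: if_cong)
  also have "\<dots> = (\<Sum>i = 1..n. f (flip x i) / real n)"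
    unfolding neighbours_eq_flips[OF assms] sum.reindex[OF inj_on_flip[OF assms]] o_def ..
  finally show ?thesis by (simp add: neighbour_avg_def sum_divide_distrib)
qed

lemma transition_nonneg: "x \<in> hypercube n \<Longrightarrow> 0 \<le> transition n k x y"
  by (induction k arbitrary: x) (auto intro: neighbour_avg_nonneg)

lemma sum_transition:
  assumes "n \<ge> 1" "x \<in> hypercube n"
  shows "(\<Sum>y\<in>hypercube n. transition n k x y) = 1"
  using assms(2)
proof (induction k arbitrary: x)
  case (Suc k)
  have "(\<Sum>y\<in>hypercube n. transition n (Suc k) x y) =
      neighbour_avg n (\<lambda>z. \<Sum>y\<in>hypercube n. transition n k z y) x"
    by (simp add: neighbour_avg_sum)
  also have "\<dots> = neighbour_avg n (\<lambda>_. 1) x"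
    using Suc by (intro neighbour_avg_cong) auto
  finally show ?case using assms by (simp add: neighbour_avg_const)
qed simp

section \<open>Expected visits and survival\<close>

definition mean_hits :: "nat \<Rightarrow> (nat \<Rightarrow> vertex set) \<Rightarrow> nat \<Rightarrow> vertex \<Rightarrow> real" where
  "mean_hits n D N x = (\<Sum>k = 1..N. \<Sum>y\<in>D k. transition n k x y)"

text \<open>The probability that the walk started in \<open>x\<close> is outside \<open>D k\<close> at each time
\<open>k = 1, ..., N\<close>, computed by conditioning on the first step. The position at time \<open>0\<close>
is not constrained, so that survival over consecutive blocks of time composes without
overlap. The forbidden set may depend on time because visits will be ignored during the
mixing period of each block.\<close>

fun survival :: "nat \<Rightarrow> (nat \<Rightarrow> vertex set) \<Rightarrow> nat \<Rightarrow> vertex \<Rightarrow> real" where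
  "survival n D 0 x = 1"
| "survival n D (Suc N) x =
     neighbour_avg n (\<lambda>y. if y \<in> D 1 then 0 else survival n (\<lambda>k. D (k + 1)) N y) x"

lemma mean_hits_0 [simp]: "mean_hits n D 0 x = 0"
  by (simp add: mean_hits_def)

lemma mean_hits_Suc:
  assumes "\<And>k. D k \<subseteq> hypercube n"
  shows "mean_hits n D (Suc N) x =
    neighbour_avg n (\<lambda>y. of_bool (y \<in> D 1) + mean_hits n (\<lambda>k. D (k + 1)) N y) x"
proof -
  have fin: "finite (D k)" for k using assms finite_hypercube by (rule finite_subset)
  have *: "(\<Sum>y\<in>D (Suc k). transition n (Suc k) x y) =
      neighbour_avg n (\<lambda>z. \<Sum>y\<in>D (Suc k). transition n k z y) x" for k
    by (simp add: neighbour_avg_sum)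
  have "mean_hits n D (Suc N) x = (\<Sum>k=0..N. \<Sum>y\<in>D (Suc k). transition n (Suc k) x y)"
    unfolding mean_hits_def by (simp only: sum.shift_bounds_cl_Suc_ivl One_nat_def)
  also have "\<dots> = (\<Sum>k=0..N. neighbour_avg n (\<lambda>z. \<Sum>y\<in>D (Suc k). transition n k z y) x)"
    by (simp only: *)
  also have "\<dots> = neighbour_avg n (\<lambda>z. \<Sum>k=0..N. \<Sum>y\<in>D (Suc k). transition n k z y) x"
    by (simp only: neighbour_avg_sum)
  also have "(\<lambda>z. \<Sum>k=0..N. \<Sum>y\<in>D (Suc k). transition n k z y) =
      (\<lambda>y. of_bool (y \<in> D 1) + mean_hits n (\<lambda>k. D (k + 1)) N y)"
    by (rule ext, subst sum.atLeast_Suc_atMost) (simp_all add: mean_hits_def of_bool_def fin)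
  finally show ?thesis .
qed

lemma mean_hits_nonneg: "x \<in> hypercube n \<Longrightarrow> 0 \<le> mean_hits n D N x"
  unfolding mean_hits_def by (intro sum_nonneg transition_nonneg)

lemma survival_nonneg: "x \<in> hypercube n \<Longrightarrow> 0 \<le> survival n D N x"
  by (induction N arbitrary: D x) (auto intro!: neighbour_avg_nonneg)

lemma survival_le_1: "n \<ge> 1 \<Longrightarrow> x \<in> hypercube n \<Longrightarrow> survival n D N x \<le> 1"
  by (induction N arbitrary: D x) (auto intro!: neighbour_avg_le)

lemma survival_antimono_set:
  assumes "\<And>k. D k \<subseteq> D' k" "x \<in> hypercube n"
  shows "survival n D' N x \<le> survival n D N x"
  using assms
proof (induction N arbitrary: D D' x)
  case (Suc N)
  have D: "D (Suc 0) \<subseteq> D' (Suc 0)" by (rule Suc)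
  show ?case unfolding survival.simps
    using Suc.prems D by (intro neighbour_avg_mono) (auto intro!: Suc survival_nonneg)
qed simp

lemma one_minus_survival_le_mean_hits:
  assumes "n \<ge> 1" "\<And>k. D k \<subseteq> hypercube n" "x \<in> hypercube n"
  shows "1 - survival n D N x \<le> mean_hits n D N x"
  using assms(2,3)
proof (induction N arbitrary: D x)
  case (Suc N)
  have "1 - survival n D (Suc N) x = neighbour_avg n (\<lambda>y. 1 -
      (if y \<in> D 1 then 0 else survival n (\<lambda>k. D (k + 1)) N y)) x"
    using assms(1) by (simp add: neighbour_avg_diff neighbour_avg_const)
  also have "\<dots> \<le> mean_hits n D (Suc N) x"
    unfolding mean_hits_Suc[OF Suc.prems(1)] 
  proof (rule neighbour_avg_mono[OF Suc.prems(2)])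
    fix y assume y: "y \<in> hypercube n"
    show "1 - (if y \<in> D 1 then 0 else survival n (\<lambda>k. D (k + 1)) N y)
         \<le> of_bool (y \<in> D 1) + mean_hits n (\<lambda>k. D (k + 1)) N y"
      using Suc.IH[of "\<lambda>k. D (k + 1)" y] Suc.prems y mean_hits_nonneg[OF y, of "\<lambda>k. D (k + 1)" N]
      by auto
  qed
  finally show ?case .
qed simp

text \<open>A quantitative form of the absence of clustering: once the first visit has happened, at
most \<open>\<epsilon>\<close> further visits are expected, so the expected number of visits is at most
\<open>1 + \<epsilon>\<close> times the probability of a visit. In the induction on the first step, the case
of a visit at time \<open>1\<close> reduces to \<open>(1 - \<epsilon>) * (1 + \<epsilon>) <= 1\<close>.\<close>

lemma one_minus_survival_ge_mean_hits:
  assumes "n \<ge> 1" "\<And>k. D k \<subseteq> hypercube n" "x \<in> hypercube n" "0 \<le> \<epsilon>" "\<epsilon> \<le> 1"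
    and "\<And>j N y. y \<in> hypercube n \<Longrightarrow> N + j \<le> K \<Longrightarrow> mean_hits n (\<lambda>k. D (k + j)) N y \<le> \<epsilon>"
    and "N \<le> K"
  shows "(1 - \<epsilon>) * mean_hits n D N x \<le> 1 - survival n D N x"
  using assms(2,3,6,7)
proof (induction N arbitrary: D x K)
  case (Suc N)
  let ?D = "\<lambda>k. D (k + 1)"
  obtain K' where K: "K = Suc K'" using Suc.prems by (cases K) auto
  have small: "mean_hits n (\<lambda>k. ?D (k + j)) N' y \<le> \<epsilon>" if "y \<in> hypercube n" "N' + j \<le> K'" for j N' y
    using Suc.prems(3)[of y N' "Suc j"] that K by (simp add: ac_simps)
  have "(1 - \<epsilon>) * mean_hits n D (Suc N) x =
      neighbour_avg n (\<lambda>y. (1 - \<epsilon>) * (of_bool (y \<in> D 1) + mean_hits n ?D N y)) x"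
    unfolding mean_hits_Suc[OF Suc.prems(1)] neighbour_avg_cmult ..
  also have "\<dots> \<le> neighbour_avg n (\<lambda>y. 1 - (if y \<in> D 1 then 0 else survival n ?D N y)) x"
  proof (rule neighbour_avg_mono[OF Suc.prems(2)])
    fix y assume y: "y \<in> hypercube n"
    have "(1 - \<epsilon>) * (1 + mean_hits n ?D N y) \<le> (1 - \<epsilon>) * (1 + \<epsilon>)"
      using small[of y N 0] y Suc.prems K assms(5) by (intro mult_left_mono) auto
    also have "\<dots> \<le> 1" by (simp add: algebra_simps)
    finally show "(1 - \<epsilon>) * (of_bool (y \<in> D 1) + mean_hits n ?D N y)
        \<le> 1 - (if y \<in> D 1 then 0 else survival n ?D N y)"
      using Suc.IH[of ?D y K'] Suc.prems small y K by auto
  qed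
  also have "\<dots> = 1 - survival n D (Suc N) x"
    using assms(1) by (simp add: neighbour_avg_diff neighbour_avg_const)
  finally show ?case .
qed simp

text \<open>Forbidding the sets \<open>D' k\<close> in addition costs at most the expected number of visits to
them.\<close>

lemma survival_Un_ge:
  assumes "n \<ge> 1" "\<And>k. D' k \<subseteq> hypercube n" "x \<in> hypercube n"
  shows "survival n D N x - mean_hits n D' N x \<le> survival n (\<lambda>k. D k \<union> D' k) N x"
  using assms(2,3)
proof (induction N arbitrary: D D' x)
  case (Suc N)
  let ?D = "\<lambda>k. D (k + 1)" and ?D' = "\<lambda>k. D' (k + 1)"
  have "survival n D (Suc N) x - mean_hits n D' (Suc N) x =
     neighbour_avg n (\<lambda>y. (if y \<in> D 1 then 0 else survival n ?D N y) -
       (of_bool (y \<in> D' 1) + mean_hits n ?D' N y)) x"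
    unfolding mean_hits_Suc[OF Suc.prems(1)] neighbour_avg_diff by simp
  also have "\<dots> \<le> survival n (\<lambda>k. D k \<union> D' k) (Suc N) x"
    unfolding survival.simps
  proof (rule neighbour_avg_mono[OF Suc.prems(2)])
    fix y assume y: "y \<in> hypercube n"
    show "(if y \<in> D 1 then 0 else survival n ?D N y) - (of_bool (y \<in> D' 1) + mean_hits n ?D' N y)
      \<le> (if y \<in> D 1 \<union> D' 1 then 0 else survival n (\<lambda>k. D (k + 1) \<union> D' (k + 1)) N y)"
      using Suc.IH[of ?D' y ?D] Suc.prems(1) y mean_hits_nonneg[OF y, of ?D' N]
        survival_le_1[OF assms(1) y, of ?D N] by auto
  qed
  finally show ?case .
qed simp

text \<open>The Markov property at time \<open>N\<close>, with the survival after time \<open>N\<close> bounded uniformly over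
the position.\<close>

lemma survival_add_le:
  assumes "x \<in> hypercube n" "\<And>y. y \<in> hypercube n \<Longrightarrow> survival n (\<lambda>k. D (k + N)) N' y \<le> \<beta>"
  shows "survival n D (N + N') x \<le> survival n D N x * \<beta>"
  using assms
proof (induction N arbitrary: D x)
  case (Suc N)
  let ?D = "\<lambda>k. D (k + 1)"
  have "survival n D (Suc N + N') x \<le>
      neighbour_avg n (\<lambda>y. \<beta> * (if y \<in> D 1 then 0 else survival n ?D N y)) x"
    unfolding survival.simps add_Suc using Suc.prems Suc.IH[of _ ?D]
    by (intro neighbour_avg_mono) (auto simp: mult.commute)
  then show ?case by (simp add: neighbour_avg_cmult mult.commute)
qed auto

lemma survival_add_ge:
  assumes "x \<in> hypercube n" "\<And>y. y \<in> hypercube n \<Longrightarrow> \<beta> \<le> survival n (\<lambda>k. D (k + N)) N' y"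
  shows "survival n D N x * \<beta> \<le> survival n D (N + N') x"
  using assms
proof (induction N arbitrary: D x)
  case (Suc N)
  let ?D = "\<lambda>k. D (k + 1)"
  have "neighbour_avg n (\<lambda>y. \<beta> * (if y \<in> D 1 then 0 else survival n ?D N y)) x
      \<le> survival n D (Suc N + N') x"
    unfolding survival.simps add_Suc using Suc.prems Suc.IH[of _ ?D]
    by (intro neighbour_avg_mono) (auto simp: mult.commute)
  then show ?case by (simp add: neighbour_avg_cmult mult.commute)
qed auto

lemma survival_periodic_le:
  assumes "x \<in> hypercube n" "\<And>k. D (k + L) = D k" "0 \<le> \<beta>"
    and "\<And>y. y \<in> hypercube n \<Longrightarrow> survival n D L y \<le> \<beta>"
  shows "survival n D (q * L) x \<le> \<beta> ^ q"
  using assms(1)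
proof (induction q arbitrary: x)
  case (Suc q)
  have "survival n D (L + q * L) x \<le> survival n D L x * \<beta> ^ q"
    using Suc assms(2) by (intro survival_add_le) auto
  also have "\<dots> \<le> \<beta> * \<beta> ^ q" using assms Suc by (intro mult_right_mono) auto
  finally show ?case by simp
qed simp

lemma survival_periodic_ge:
  assumes "x \<in> hypercube n" "\<And>k. D (k + L) = D k" "0 \<le> \<beta>"
    and "\<And>y. y \<in> hypercube n \<Longrightarrow> \<beta> \<le> survival n D L y"
  shows "\<beta> ^ q \<le> survival n D (q * L) x"
  using assms(1)
proof (induction q arbitrary: x)
  case (Suc q)
  have "\<beta> * \<beta> ^ q \<le> survival n D L x * \<beta> ^ q" using assms Suc by (intro mult_right_mono) auto
  also have "\<dots> \<le> survival n D (L + q * L) x"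
    using Suc assms(2) by (intro survival_add_ge) auto
  finally show ?case by simp
qed simp

lemma survival_antimono_time:
  assumes "n \<ge> 1" "x \<in> hypercube n" "N \<le> N'"
  shows "survival n D N' x \<le> survival n D N x"
  using survival_add_le[of x n D N "N' - N" 1] assms by (simp add: survival_le_1)

lemma mean_hits_mono:
  assumes "x \<in> hypercube n" "\<And>k. k \<in> {1..N} \<Longrightarrow> D k \<subseteq> D' k" "\<And>k. D' k \<subseteq> hypercube n" "N \<le> N'"
  shows "mean_hits n D N x \<le> mean_hits n D' N' x"
proof -
  have fin: "finite (D' k)" for k using assms(3) finite_hypercube by (rule finite_subset)
  have "mean_hits n D N x \<le> mean_hits n D' N x"
    unfolding mean_hits_def using assms fin
    by (intro sum_mono sum_mono2) (auto intro: transition_nonneg)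
  also have "\<dots> \<le> mean_hits n D' N' x"
    unfolding mean_hits_def using assms
    by (intro sum_mono2) (auto intro!: sum_nonneg transition_nonneg)
  finally show ?thesis .
qed

section \<open>Spectral bounds for the transition kernel\<close>

text \<open>The value at \<open>x + y\<close> of the character of the group \<open>(\<int>/2\<int>)\<^sup>n\<close> indexed by \<open>S\<close>. These
characters diagonalise the walk.\<close>

definition walsh :: "nat set \<Rightarrow> vertex \<Rightarrow> vertex \<Rightarrow> real" where
  "walsh S x y = (\<Prod>i\<in>S. if x i = y i then 1 else -1)"

definition eigenvalue :: "nat \<Rightarrow> nat set \<Rightarrow> real" where
  "eigenvalue n S = 1 - 2 * real (card S) / real n"

lemma sum_Pow_prod:
  fixes c :: "'a \<Rightarrow> 'b :: comm_ring_1"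
  assumes "finite I"
  shows "(\<Sum>S\<in>Pow I. \<Prod>i\<in>S. c i) = (\<Prod>i\<in>I. 1 + c i)"
  using prod_add[OF assms, of c "\<lambda>_. 1"] by (simp add: add.commute)

lemma sum_Pow_power_card:
  fixes c :: real
  shows "(\<Sum>S\<in>Pow {1..n}. c ^ card S) = (1 + c) ^ n"
  using sum_Pow_prod[of "{1..n}" "\<lambda>_. c"] by simp

lemma sum_Pow_power_card_compl:
  fixes c :: real
  shows "(\<Sum>S\<in>Pow {1..n}. c ^ (n - card S)) = (1 + c) ^ n"
proof -
  have "(\<Sum>S\<in>Pow {1..n}. c ^ (n - card S)) = (\<Sum>S\<in>Pow {1..n}. c ^ card ({1..n} - S))"
    by (intro sum.cong refl) (auto simp: card_Diff_subset finite_subset)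
  also have "\<dots> = (\<Sum>S\<in>Pow {1..n}. c ^ card S)"
    by (rule sum.reindex_bij_witness[of _ "\<lambda>S. {1..n} - S" "\<lambda>S. {1..n} - S"]) 
      (auto simp: double_diff)
  finally show ?thesis unfolding sum_Pow_power_card .
qed

lemma abs_walsh_le: "\<bar>walsh S x y\<bar> \<le> 1"
  unfolding walsh_def abs_prod by (intro prod_le_1) auto

lemma sum_walsh:
  assumes "x \<in> hypercube n" "y \<in> hypercube n"
  shows "(\<Sum>S\<in>Pow {1..n}. walsh S x y) = 2 ^ n * of_bool (x = y)"
proof (cases "x = y")
  case True
  then show ?thesis by (simp add: walsh_def card_Pow)
next
  case False
  have "\<exists>i\<in>{1..n}. x i \<noteq> y i"
  proof (rule ccontr)
    assume "\<not> (\<exists>i\<in>{1..n}. x i \<noteq> y i)"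
    then have "x = y" using assms unfolding hypercube_def by (intro PiE_ext) auto
    then show False using False by simp
  qed
  then have "(\<Prod>i\<in>{1..n}. 1 + (if x i = y i then 1 else -1 :: real)) = 0"
    by (intro prod_zero) auto
  then show ?thesis using False by (simp add: walsh_def sum_Pow_prod)
qed

lemma walsh_flip:
  assumes "x \<in> hypercube n" "y \<in> hypercube n" "i \<in> {1..n}" "S \<subseteq> {1..n}"
  shows "walsh S (flip x i) y = walsh S x y * (if i \<in> S then -1 else 1)"
proof -
  have fin: "finite S" using assms(4) by (rule finite_subset) simp
  have "x i \<in> {0, 1}" "y i \<in> {0, 1}" using assms by (auto simp: hypercube_def PiE_iff)
  then have *: "(if flip x i j = y j then 1 else - 1 :: real) =
      (if x j = y j then 1 else -1) * (if j = i then -1 else 1)" for j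
    by (auto simp: flip_def)
  show ?thesis unfolding walsh_def * prod.distrib using fin by (simp add: prod.delta)
qed

text \<open>Flipping coordinate \<open>i\<close> multiplies the character of \<open>S\<close> by \<open>-1\<close> if \<open>i \<in> S\<close> and leaves it
unchanged otherwise. Averaging over \<open>i\<close> therefore multiplies it by \<open>(n - 2 |S|) / n\<close>,
which is the eigenvalue.\<close>

lemma transition_fourier:
  assumes "n \<ge> 1" "x \<in> hypercube n" "y \<in> hypercube n"
  shows "transition n k x y = (\<Sum>S\<in>Pow {1..n}. walsh S x y * eigenvalue n S ^ k) / 2 ^ n"
  using assms(2)
proof (induction k arbitrary: x)
  case 0
  then show ?case unfolding power_0 mult_1_right sum_walsh[OF 0 assms(3)] by simp
next
  case (Suc k)
  have avg: "neighbour_avg n (\<lambda>z. walsh S z y) x = walsh S x y * eigenvalue n S"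
    if S: "S \<in> Pow {1..n}" for S
  proof -
    have "(\<Sum>i = 1..n. walsh S (flip x i) y) = (\<Sum>i = 1..n. walsh S x y * (if i \<in> S then -1 else 1))"
      using S Suc.prems assms by (intro sum.cong refl walsh_flip) auto
    also have "\<dots> = walsh S x y * (\<Sum>i\<in>{1..n}. 1 - 2 * of_bool (i \<in> S))"
      unfolding sum_distrib_left[symmetric] by (intro arg_cong2[of _ _ _ _ "(*)"] sum.cong) auto
    also have "(\<Sum>i\<in>{1..n}. 1 - 2 * of_bool (i \<in> S) :: real) = real n - 2 * real (card S)"
      using S by (simp add: sum_subtractf sum_distrib_left[symmetric] of_bool_def sum.If_cases
          Int_absorb1 Int_def[symmetric])
    finally show ?thesis using assms(1)
      by (simp add: neighbour_avg_def eigenvalue_def field_simps)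
  qed
  have "transition n (Suc k) x y = neighbour_avg n (\<lambda>z. \<Sum>S\<in>Pow {1..n}.
      eigenvalue n S ^ k / 2 ^ n * walsh S z y) x"
    unfolding transition.simps using Suc
    by (intro neighbour_avg_cong) (auto simp: sum_divide_distrib mult_ac)
  also have "\<dots> = (\<Sum>S\<in>Pow {1..n}. eigenvalue n S ^ k / 2 ^ n * (walsh S x y * eigenvalue n S))"
    unfolding neighbour_avg_sum neighbour_avg_cmult by (intro sum.cong refl) (simp only: avg)
  finally show ?case by (simp add: sum_divide_distrib mult_ac)
qed

text \<open>True after one step, and averaging over the first step preserves an upper bound that is
uniform in the starting point.\<close>

lemma transition_le_inverse_dim:
  assumes "n \<ge> 1" "x \<in> hypercube n" "y \<in> hypercube n" "k \<ge> 1"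
  shows "transition n k x y \<le> 1 / real n"
proof -
  have "transition n (Suc k) x y \<le> 1 / real n" if "x \<in> hypercube n" for k x
    using that
  proof (induction k arbitrary: x)
    case 0
    have "transition n 1 x y = (\<Sum>z\<in>hypercube n. srw_step n x z * of_bool (z = y))"
      using sum_srw_step[OF 0, of "\<lambda>z. of_bool (z = y)"] by simp
    also have "\<dots> = srw_step n x y" using assms(3)
      by (simp add: of_bool_def if_distrib[of "\<lambda>u. _ * u"] cong: if_cong)
    also have "\<dots> \<le> 1 / real n" by (simp add: srw_step_def)
    finally show ?case by simp
  next
    case (Suc k)
    then show ?case using assms(1) by (subst transition.simps) (auto intro: neighbour_avg_le)
  qed
  then show ?thesis using assms by (cases k) auto
qed

lemma abs_eigenvalue_le_1:
  assumes "n \<ge> 1" "S \<subseteq> {1..n}"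
  shows "\<bar>eigenvalue n S\<bar> \<le> 1"
proof -
  have "card S \<le> n" using card_mono[OF _ assms(2)] by simp
  then show ?thesis using assms(1) by (simp add: eigenvalue_def abs_le_iff field_simps)
qed

lemma power6_le_exp: "(x::real) ^ 6 \<le> 46656 * (exp x + exp (-x))"
proof -
  have "(\<bar>x\<bar> / 6) ^ 6 \<le> exp (\<bar>x\<bar> / 6) ^ 6"
    using exp_ge_add_one_self[of "\<bar>x\<bar> / 6"] by (intro power_mono) linarith+
  also have "\<dots> = exp \<bar>x\<bar>" using exp_of_nat_mult[of 6 "\<bar>x\<bar> / 6"] by simp
  also have "\<dots> \<le> exp x + exp (-x)" by (cases "x \<ge> 0") auto
  finally show ?thesis by (simp add: power_divide)
qed

lemma exp_plus_exp_minus_le: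
  fixes s :: real
  assumes "0 \<le> s" "s \<le> 1"
  shows "exp s + exp (- s) \<le> 2 * exp (s\<^sup>2)"
proof -
  have "exp (- s) \<le> 1 - s + s\<^sup>2"
  proof -
    have "exp (- s) = 1 / exp s" by (simp add: exp_minus inverse_eq_divide)
    also have "\<dots> \<le> 1 / (1 + s)" using assms exp_ge_add_one_self[of s] by (intro divide_left_mono) auto
    also have "\<dots> \<le> 1 - s + s\<^sup>2"
    proof -
      have "(1 - s + s\<^sup>2) * (1 + s) = 1 + s ^ 3" by (simp add: algebra_simps power2_eq_square power3_eq_cube)
      then have "(1 - s + s\<^sup>2) * (1 + s) \<ge> 1" using assms by simp
      then show ?thesis using assms by (simp add: divide_le_eq)
    qed
    finally show ?thesis .
  qed
  moreover have "exp s \<le> 1 + s + s\<^sup>2" using assms by (rule exp_bound)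
  ultimately have "exp s + exp (- s) \<le> 2 * (1 + s\<^sup>2)" by simp
  also have "\<dots> \<le> 2 * exp (s\<^sup>2)" using exp_ge_add_one_self[of "s\<^sup>2"] by (intro mult_left_mono) auto
  finally show ?thesis .
qed

text \<open>Up to the factor \<open>2 ^ n\<close> this is the moment generating function of a normalised sum of
\<open>n\<close> independent signs, whose law is the distribution of \<open>sqrt n\<close> times the eigenvalue of
a uniformly chosen \<open>S\<close>.\<close>

lemma sum_exp_eigenvalue:
  assumes "n \<ge> 1"
  shows "(\<Sum>S\<in>Pow {1..n}. exp (c * sqrt n * eigenvalue n S)) =
    (exp (c / sqrt n) + exp (- (c / sqrt n))) ^ n"
proof -
  have n: "real n = sqrt n * sqrt n" by simp
  have "exp (c * sqrt n * eigenvalue n S) = exp (c / sqrt n) ^ n * exp (- 2 * c / sqrt n) ^ card S" for S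
    using assms unfolding eigenvalue_def exp_of_nat_mult[symmetric] exp_add[symmetric]
    by (subst (3 4) n) (simp add: field_simps)
  then have "(\<Sum>S\<in>Pow {1..n}. exp (c * sqrt n * eigenvalue n S)) =
      exp (c / sqrt n) ^ n * (1 + exp (- 2 * c / sqrt n)) ^ n"
    by (simp add: sum_distrib_left[symmetric] sum_Pow_power_card[simplified])
  also have "\<dots> = (exp (c / sqrt n) + exp (- (c / sqrt n))) ^ n"
    unfolding power_mult_distrib[symmetric] by (simp add: algebra_simps exp_add[symmetric])
  finally show ?thesis .
qed

text \<open>By the spectral formula the kernel is at most the mean of \<open>|eigenvalue| ^ 6\<close>, which is
the sixth moment of the mean of \<open>n\<close> independent signs, hence of order \<open>n\<^sup>-\<^sup>3\<close>. The moment
is estimated by \<open>u ^ 6 = O(exp u + exp (- u))\<close> and the moment generating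
function.\<close>

lemma transition_le_inverse_dim_cubed:
  assumes "n \<ge> 1" "x \<in> hypercube n" "y \<in> hypercube n" "k \<ge> 6"
  shows "transition n k x y \<le> 300000 / real n ^ 3"
proof -
  let ?e = "\<lambda>S. exp (1 * sqrt n * eigenvalue n S) + exp (-1 * sqrt n * eigenvalue n S)"
  have b: "walsh S x y * eigenvalue n S ^ k \<le> 46656 / real n ^ 3 * ?e S" if S: "S \<in> Pow {1..n}" for S
  proof -
    have "walsh S x y * eigenvalue n S ^ k \<le> \<bar>walsh S x y\<bar> * \<bar>eigenvalue n S\<bar> ^ k"
      by (metis abs_ge_self abs_mult power_abs)
    also have "\<dots> \<le> 1 * \<bar>eigenvalue n S\<bar> ^ k"
      by (intro mult_right_mono abs_walsh_le) auto
    also have "\<dots> \<le> \<bar>eigenvalue n S\<bar> ^ 6"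
      unfolding mult_1_left using abs_eigenvalue_le_1[of n S] S assms
      by (intro power_decreasing) auto
    also have "\<dots> = (sqrt n * eigenvalue n S) ^ 6 / real n ^ 3"
    proof -
      have "sqrt n ^ 6 = (sqrt n ^ 2) ^ 3" by (simp only: power_mult[symmetric]) simp
      then show ?thesis using assms(1) by (simp add: power_mult_distrib)
    qed
    also have "\<dots> \<le> 46656 * ?e S / real n ^ 3"
      using power6_le_exp[of "sqrt n * eigenvalue n S"] by (intro divide_right_mono) auto
    finally show ?thesis by simp
  qed
  have s: "0 \<le> 1 / sqrt n" "1 / sqrt n \<le> 1" using assms by auto
  have "(exp (1 / sqrt n) + exp (- (1 / sqrt n))) ^ n \<le> (2 * exp ((1 / sqrt n)\<^sup>2)) ^ n"
    by (intro power_mono exp_plus_exp_minus_le[OF s] add_nonneg_nonneg) auto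
  also have "\<dots> = 2 ^ n * exp 1"
    using assms by (simp add: power_mult_distrib power_divide exp_of_nat_mult[symmetric])
  also have "\<dots> \<le> 2 ^ n * 3" using exp_le by simp
  finally have cosh: "(exp (1 / sqrt n) + exp (- (1 / sqrt n))) ^ n \<le> 2 ^ n * 3" .
  have "(\<Sum>S\<in>Pow {1..n}. walsh S x y * eigenvalue n S ^ k) \<le>
      (\<Sum>S\<in>Pow {1..n}. 46656 / real n ^ 3 * ?e S)"
    by (intro sum_mono b)
  also have "\<dots> = 46656 / real n ^ 3 * (2 * (exp (1 / sqrt n) + exp (- (1 / sqrt n))) ^ n)"
    unfolding sum_distrib_left[symmetric] sum.distrib sum_exp_eigenvalue[OF assms(1)]
    by (simp add: add.commute)
  also have "\<dots> \<le> 46656 / real n ^ 3 * (2 * (2 ^ n * 3))"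
    using cosh by (intro mult_left_mono) auto
  finally have "(\<Sum>S\<in>Pow {1..n}. walsh S x y * eigenvalue n S ^ k) / 2 ^ n \<le>
      46656 / real n ^ 3 * (2 * (2 ^ n * 3)) / 2 ^ n" by (rule divide_right_mono) simp
  also have "\<dots> \<le> 300000 / real n ^ 3" by (simp add: divide_right_mono)
  finally show ?thesis using assms by (simp add: transition_fourier)
qed

text \<open>Eigenvalues near \<open>1\<close> belong to small sets \<open>S\<close> and those near \<open>-1\<close> to large ones. The two
terms on the right cover these two cases, and both can be summed over all \<open>S\<close> by the
binomial formula.\<close>

lemma abs_eigenvalue_power_le:
  assumes "n \<ge> 1" "S \<subseteq> {1..n}"
  shows "\<bar>eigenvalue n S\<bar> ^ k \<le>
    exp (- 2 * real k / real n) ^ card S + exp (- 2 * real k / real n) ^ (n - card S)"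
proof -
  have S: "card S \<le> n" using card_mono[OF _ assms(2)] by simp
  have *: "\<bar>u\<bar> ^ k \<le> exp (- 2 * real k / real n) ^ j"
    if "\<bar>u\<bar> = 1 - 2 * real j / real n" for u and j :: nat
  proof -
    have "\<bar>u\<bar> ^ k \<le> exp (- 2 * real j / real n) ^ k"
      using that exp_ge_add_one_self[of "- 2 * real j / real n"] by (intro power_mono) auto
    also have "\<dots> = exp (- 2 * real k / real n) ^ j"
      by (simp add: exp_of_nat_mult[symmetric] mult_ac)
    finally show ?thesis .
  qed
  have pos: "0 \<le> exp (- 2 * real k / real n) ^ j" for j by simp
  show ?thesis
  proof (cases "eigenvalue n S \<ge> 0")
    case True
    then have "\<bar>eigenvalue n S\<bar> = 1 - 2 * real (card S) / real n" by (simp add: eigenvalue_def)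
    then show ?thesis using *[of "eigenvalue n S" "card S"] pos[of "n - card S"] by linarith
  next
    case False
    \<comment> \<open>Passing to the complement of \<open>S\<close> changes the sign of the eigenvalue.\<close>
    then have "\<bar>eigenvalue n S\<bar> = 1 - 2 * real (n - card S) / real n"
      using S assms(1) by (simp add: eigenvalue_def of_nat_diff field_simps)
    then show ?thesis using *[of "eigenvalue n S" "n - card S"] pos[of "card S"] by linarith
  qed
qed

text \<open>In the sum of two consecutive kernels the character of \<open>S\<close> has the coefficient
\<open>\<lambda> ^ k * (1 + \<lambda>)\<close>. It equals \<open>2\<close> for the empty set, which is the uniform law counted
twice, and \<open>0\<close> for the full set, which is the parity obstruction. At time \<open>n ln n\<close> the
remaining coefficients sum to \<open>O((1 + n\<^sup>-\<^sup>2) ^ n - 1)\<close>.\<close>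

lemma transition_two_steps_near_uniform:
  assumes "n \<ge> 1" "x \<in> hypercube n" "y \<in> hypercube n" "real k \<ge> real n * ln (real n)"
  shows "\<bar>transition n k x y + transition n (Suc k) x y - 2 / 2 ^ n\<bar> \<le> 8 / real n / 2 ^ n"
proof -
  let ?c = "exp (- 2 * real k / real n)" and ?U = "{1..n}"
  let ?f = "\<lambda>S. walsh S x y * (eigenvalue n S ^ k * (1 + eigenvalue n S))"
  have c: "0 \<le> ?c" "?c \<le> 1 / real n ^ 2"
  proof -
    have "?c \<le> exp (- 2 * ln (real n))"
      using assms(1,4) by (simp add: field_simps)
    also have "\<dots> = 1 / real n ^ 2"
      using assms(1) exp_of_nat_mult[of 2 "ln (real n)"] by (simp add: exp_minus inverse_eq_divide)
    finally show "?c \<le> 1 / real n ^ 2" .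
  qed simp
  have pow: "(1 + ?c) ^ n - 1 \<le> 2 / real n"
  proof -
    have "(1 + ?c) ^ n \<le> exp (1 / real n ^ 2) ^ n"
      using c exp_ge_add_one_self[of "1 / real n ^ 2"] by (intro power_mono) (auto simp del: exp_ge_add_one_self)
    also have "\<dots> = exp (1 / real n)"
      using assms(1) by (simp add: exp_of_nat_mult[symmetric] power2_eq_square)
    also have "\<dots> \<le> 1 + 1 / real n + (1 / real n)\<^sup>2"
      using assms(1) by (intro exp_bound) auto
    also have "\<dots> \<le> 1 + 2 / real n"
      using assms(1) by (simp add: power2_eq_square field_simps)
    finally show ?thesis by simp
  qed
  have full: "?f ?U = 0" using assms(1) by (simp add: eigenvalue_def)
  have empty: "?f {} = 2" by (simp add: walsh_def eigenvalue_def)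
  have ne: "{} \<noteq> ?U" using assms(1) by auto
  define R where "R = Pow ?U - {{}, ?U}"
  have split: "(\<Sum>S\<in>Pow ?U. g S) = g {} + g ?U + (\<Sum>S\<in>R. g S)" for g :: "nat set \<Rightarrow> real"
  proof -
    have "(\<Sum>S\<in>Pow ?U. g S) = (\<Sum>S\<in>Pow ?U - {{}, ?U}. g S) + (\<Sum>S\<in>{{}, ?U}. g S)"
      by (rule sum.subset_diff) auto
    then show ?thesis using ne by (simp add: R_def)
  qed
  have term_bound: "\<bar>?f S\<bar> \<le> 2 * (?c ^ card S + ?c ^ (n - card S))" if S: "S \<in> R" for S
  proof -
    have SU: "S \<subseteq> ?U" using S by (auto simp: R_def)
    have "\<bar>?f S\<bar> = \<bar>walsh S x y\<bar> * (\<bar>eigenvalue n S\<bar> ^ k * \<bar>1 + eigenvalue n S\<bar>)"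
      by (simp add: abs_mult power_abs)
    also have "\<dots> \<le> 1 * (\<bar>eigenvalue n S\<bar> ^ k * 2)"
      using abs_walsh_le[of S x y] abs_eigenvalue_le_1[OF assms(1) SU]
      by (intro mult_mono) auto
    also have "\<dots> \<le> 2 * (?c ^ card S + ?c ^ (n - card S))"
      using abs_eigenvalue_power_le[OF assms(1) SU, of k] by simp
    finally show ?thesis .
  qed
  have R1: "(\<Sum>S\<in>R. ?c ^ card S) \<le> (1 + ?c) ^ n - 1"
    using split[of "\<lambda>S. ?c ^ card S"] zero_le_power[OF c(1), of n]
    unfolding sum_Pow_power_card card.empty power_0 card_atLeastAtMost by simp
  have R2: "(\<Sum>S\<in>R. ?c ^ (n - card S)) \<le> (1 + ?c) ^ n - 1"
    using split[of "\<lambda>S. ?c ^ (n - card S)"] zero_le_power[OF c(1), of n]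
    unfolding sum_Pow_power_card_compl by simp
  have "\<bar>\<Sum>S\<in>R. ?f S\<bar> \<le> (\<Sum>S\<in>R. \<bar>?f S\<bar>)" by (rule sum_abs)
  also have "\<dots> \<le> (\<Sum>S\<in>R. 2 * (?c ^ card S + ?c ^ (n - card S)))" by (intro sum_mono term_bound)
  also have "\<dots> = 2 * ((\<Sum>S\<in>R. ?c ^ card S) + (\<Sum>S\<in>R. ?c ^ (n - card S)))"
    by (simp only: sum_distrib_left[symmetric] sum.distrib)
  also have "\<dots> \<le> 2 * (2 / real n + 2 / real n)"
    using R1 R2 pow by (intro mult_left_mono add_mono) linarith+
  finally have R: "\<bar>\<Sum>S\<in>R. ?f S\<bar> \<le> 8 / real n" by simp
  have "transition n k x y + transition n (Suc k) x y = (\<Sum>S\<in>Pow ?U. ?f S) / 2 ^ n"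
    using assms by (simp only: transition_fourier add_divide_distrib[symmetric] sum.distrib[symmetric])
      (simp add: algebra_simps)
  also have "\<dots> = 2 / 2 ^ n + (\<Sum>S\<in>R. ?f S) / 2 ^ n"
    using split[of ?f] full empty by (simp add: add_divide_distrib)
  finally have "\<bar>transition n k x y + transition n (Suc k) x y - 2 / 2 ^ n\<bar> = \<bar>\<Sum>S\<in>R. ?f S\<bar> / 2 ^ n" by simp
  also have "\<dots> \<le> 8 / real n / 2 ^ n" using R by (intro divide_right_mono) auto
  finally show ?thesis .
qed

section \<open>Hitting and avoiding a set block by block\<close>

text \<open>The times at which a walk, seen in blocks of length \<open>L\<close>, is in the initial stretch of
length \<open>t\<close> of a block. Blocks consist of the times \<open>q * L + 1, ..., q * L + L\<close>.\<close>

definition gap :: "nat \<Rightarrow> nat \<Rightarrow> nat set" where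
  "gap t L = {k. k mod L \<in> {1..t}}"

lemma hits_two_steps:
  assumes "n \<ge> 1" "x \<in> hypercube n" "B \<subseteq> hypercube n" "real k \<ge> real n * ln (real n)"
  shows "\<bar>(\<Sum>y\<in>B. transition n k x y) + (\<Sum>y\<in>B. transition n (Suc k) x y)
     - 2 * (real (card B) / 2 ^ n)\<bar> \<le> 2 * (real (card B) / 2 ^ n) * (4 / real n)"
proof -
  have "(\<Sum>y\<in>B. transition n k x y) + (\<Sum>y\<in>B. transition n (Suc k) x y) - 2 * (real (card B) / 2 ^ n)
     = (\<Sum>y\<in>B. transition n k x y + transition n (Suc k) x y - 2 / 2 ^ n)"
    by (simp add: sum.distrib sum_subtractf)
  also have "\<bar>\<dots>\<bar> \<le> (\<Sum>y\<in>B. 8 / real n / 2 ^ n)"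
    using assms by (intro order_trans[OF sum_abs] sum_mono transition_two_steps_near_uniform) auto
  finally show ?thesis by (simp add: mult_ac)
qed

text \<open>At a single time the walk lives on one parity class, so the bound is twice the stationary
value.\<close>

lemma hits_one_step_le:
  assumes "n \<ge> 1" "x \<in> hypercube n" "B \<subseteq> hypercube n" "real k \<ge> real n * ln (real n)"
  shows "(\<Sum>y\<in>B. transition n k x y) \<le> 2 * (real (card B) / 2 ^ n) * (1 + 4 / real n)"
proof -
  have "0 \<le> (\<Sum>y\<in>B. transition n (Suc k) x y)"
    using assms(2) by (intro sum_nonneg transition_nonneg)
  then show ?thesis using hits_two_steps[OF assms] by (simp only: distrib_left abs_le_iff) linarith
qed

lemma hits_many_steps:
  assumes "n \<ge> 1" "x \<in> hypercube n" "B \<subseteq> hypercube n" "real t \<ge> real n * ln (real n)"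
  shows "\<bar>(\<Sum>k = t + 1..t + 2 * r. \<Sum>y\<in>B. transition n k x y)
     - 2 * real r * (real (card B) / 2 ^ n)\<bar> \<le> 2 * real r * (real (card B) / 2 ^ n) * (4 / real n)"
proof (induction r)
  case (Suc r)
  let ?F = "\<lambda>k. \<Sum>y\<in>B. transition n k x y" and ?b = "real (card B) / 2 ^ n"
  have "sum ?F {t + 1..t + 2 * Suc r} =
      sum ?F {t + 1..t + 2 * r} + (?F (t + 2 * r + 1) + ?F (Suc (t + 2 * r + 1)))"
    by simp
  moreover have "\<bar>?F (t + 2 * r + 1) + ?F (Suc (t + 2 * r + 1)) - 2 * ?b\<bar> \<le> 2 * ?b * (4 / real n)"
    using assms by (intro hits_two_steps) auto
  moreover have "2 * real (Suc r) * ?b = 2 * real r * ?b + 2 * ?b"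
    by (simp add: algebra_simps)
  ultimately show ?case using Suc.IH unfolding abs_le_iff by (simp only: distrib_right) linarith
qed simp

text \<open>A set \<open>B\<close> from which visits are rare: within one block of length \<open>t + 2 * r\<close>, at most
\<open>\<epsilon>\<close> visits are expected from any vertex. Below, \<open>D\<close> forbids \<open>B\<close> only after the mixing
period of each block, and \<open>D'\<close> only during the mixing periods, so that together they
forbid \<open>B\<close> at all times.\<close>

locale block_walk =
  fixes n t r :: nat and B :: "vertex set" and \<epsilon> :: real
  assumes n: "n \<ge> 1" and B: "B \<subseteq> hypercube n" and t: "real t \<ge> real n * ln (real n)"
    and r: "r \<ge> 1" and \<epsilon>: "0 \<le> \<epsilon>" "\<epsilon> \<le> 1"
    and hits: "\<And>x. x \<in> hypercube n \<Longrightarrow> mean_hits n (\<lambda>_. B) (t + 2 * r) x \<le> \<epsilon>"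
begin

definition "L = t + 2 * r"
definition "b = real (card B) / 2 ^ n"
definition "d = 4 / real n"
definition "D k = (if k \<in> gap t L then {} else B)"
definition "D' k = (if k \<in> gap t L then B else {})"

lemma gap_first_block: "k \<in> {1..L} \<Longrightarrow> k \<in> gap t L \<longleftrightarrow> k \<le> t"
  using r by (cases "k = L") (auto simp: gap_def L_def)

lemma b_nonneg: "0 \<le> b" and d_nonneg: "0 \<le> d" by (auto simp: b_def d_def)

lemma D_subset: "D k \<subseteq> hypercube n" "D' k \<subseteq> hypercube n" "D k \<subseteq> B" "D' k \<subseteq> B"
  using B by (auto simp: D_def D'_def)

lemma mean_hits_block:
  assumes x: "x \<in> hypercube n"
  shows "\<bar>mean_hits n D L x - 2 * real r * b\<bar> \<le> 2 * real r * b * d"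
proof -
  have "mean_hits n D L x = (\<Sum>k\<in>{1..L}. if k \<in> {t + 1..t + 2 * r} then \<Sum>y\<in>B. transition n k x y else 0)"
    unfolding mean_hits_def
  proof (intro sum.cong refl)
    fix k assume "k \<in> {1..L}"
    then show "(\<Sum>y\<in>D k. transition n k x y) =
        (if k \<in> {t + 1..t + 2 * r} then \<Sum>y\<in>B. transition n k x y else 0)"
      using gap_first_block[of k] unfolding D_def by (auto simp: L_def[symmetric])
  qed
  also have "\<dots> = (\<Sum>k\<in>{t + 1..t + 2 * r}. \<Sum>y\<in>B. transition n k x y)"
    by (subst sum.inter_restrict[symmetric]) (auto simp: L_def intro!: sum.cong)
  finally show ?thesis using hits_many_steps[OF n x B t, of r] by (simp only: b_def d_def)
qed

text \<open>Neither this bound nor the next depends on the starting point of the block, which is what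
allows them to be multiplied over the blocks.\<close>

lemma survival_block_le:
  assumes x: "x \<in> hypercube n"
  shows "survival n D L x \<le> 1 - (1 - \<epsilon>) * (2 * real r * b * (1 - d))"
proof -
  have "mean_hits n (\<lambda>k. D (k + j)) N y \<le> \<epsilon>" if "y \<in> hypercube n" "N + j \<le> L" for j N y
    using hits[OF that(1)] mean_hits_mono[OF that(1), of N "\<lambda>k. D (k + j)" "\<lambda>_. B" L] that B D_subset
    by (simp add: L_def)
  then have "(1 - \<epsilon>) * mean_hits n D L x \<le> 1 - survival n D L x"
    using one_minus_survival_ge_mean_hits[where n = n and D = D and x = x and \<epsilon> = \<epsilon> and K = L and N = L]
      n D_subset(1) x \<epsilon> by simp
  moreover have "(1 - \<epsilon>) * (2 * real r * b * (1 - d)) \<le> (1 - \<epsilon>) * mean_hits n D L x"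
    using mean_hits_block[OF x] \<epsilon> by (intro mult_left_mono) (auto simp: algebra_simps abs_le_iff)
  ultimately show ?thesis by linarith
qed

lemma survival_block_ge:
  assumes x: "x \<in> hypercube n"
  shows "1 - 2 * real r * b * (1 + d) \<le> survival n D L x"
  using one_minus_survival_le_mean_hits[of n D x L] n D_subset(1) x mean_hits_block[OF x]
  by (simp add: algebra_simps abs_le_iff)

lemma D_periodic: "D (k + L) = D k"
  by (simp add: D_def gap_def)

lemma survival_blocks_le:
  assumes "x \<in> hypercube n"
  shows "survival n (\<lambda>_. B) (q * L) x \<le> (1 - (1 - \<epsilon>) * (2 * real r * b * (1 - d))) ^ q"
proof -
  have "survival n (\<lambda>_. B) (q * L) x \<le> survival n D (q * L) x"
    using assms D_subset by (intro survival_antimono_set) auto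
  also have "\<dots> \<le> (1 - (1 - \<epsilon>) * (2 * real r * b * (1 - d))) ^ q"
    using assms survival_block_le D_periodic order_trans[OF survival_nonneg survival_block_le]
    by (intro survival_periodic_le) auto
  finally show ?thesis .
qed

text \<open>The first gap is paid for by \<open>\<epsilon>\<close>, since the walk may start next to \<open>B\<close>. At the gaps of
later blocks the walk has already mixed, and each of their times costs at most
\<open>2 * b * (1 + d)\<close>.\<close>

lemma mean_hits_gaps_le:
  assumes x: "x \<in> hypercube n"
  shows "mean_hits n D' (q * L) x \<le> \<epsilon> + real q * real t * (2 * b * (1 + d))"
proof (induction q)
  case 0
  then show ?case using \<epsilon> by simp
next
  case (Suc q)
  let ?F = "\<lambda>k. \<Sum>y\<in>D' k. transition n k x y"
  have pos: "0 \<le> real j * real t * (2 * b * (1 + d))" for j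
    using b_nonneg d_nonneg by simp
  show ?case
  proof (cases "q = 0")
    case True
    have "mean_hits n D' L x \<le> \<epsilon>"
      using hits[OF x] mean_hits_mono[OF x, of L D' "\<lambda>_. B" L] B D_subset by (simp add: L_def)
    then show ?thesis using True pos[of 1] by simp
  next
    case False
    have le: "?F (q * L + i) \<le> (if i \<in> {1..t} then 2 * b * (1 + d) else 0)" if i: "i \<in> {1..L}" for i
    proof -
      have "q * L + i \<in> gap t L \<longleftrightarrow> i \<in> gap t L" by (simp add: gap_def)
      then have g: "q * L + i \<in> gap t L \<longleftrightarrow> i \<in> {1..t}" using gap_first_block[OF i] i by auto
      have "t \<le> 1 * L" by (simp add: L_def)
      also have "\<dots> \<le> q * L + i" using False by (intro trans_le_add1 mult_le_mono1) simp
      finally have "real (q * L + i) \<ge> real n * ln (real n)" using t by linarith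
      then show ?thesis using hits_one_step_le[OF n x B, of "q * L + i"] g
        by (simp add: D'_def b_def d_def)
    qed
    have "mean_hits n D' (Suc q * L) x = mean_hits n D' (q * L) x + (\<Sum>k=q * L + 1..q * L + L. ?F k)"
      unfolding mean_hits_def mult_Suc add.commute[of L] by (rule sum.ub_add_nat) simp
    also have "(\<Sum>k=q * L + 1..q * L + L. ?F k) = (\<Sum>i=1..L. ?F (q * L + i))"
      using sum.shift_bounds_cl_nat_ivl[of ?F 1 "q * L" L] by (simp add: add.commute)
    also have "\<dots> \<le> (\<Sum>i=1..L. if i \<in> {1..t} then 2 * b * (1 + d) else 0)"
      by (intro sum_mono le)
    also have "\<dots> = real t * (2 * b * (1 + d))"
      by (subst sum.inter_restrict[symmetric]) (auto simp: L_def Int_absorb1)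
    finally have "mean_hits n D' (Suc q * L) x \<le> mean_hits n D' (q * L) x + real t * (2 * b * (1 + d))"
      by simp
    then show ?thesis using Suc.IH by (simp add: algebra_simps)
  qed
qed

lemma survival_blocks_ge:
  assumes x: "x \<in> hypercube n" and small: "2 * real r * b * (1 + d) \<le> 1"
  shows "(1 - 2 * real r * b * (1 + d)) ^ q - (\<epsilon> + real q * real t * (2 * b * (1 + d)))
     \<le> survival n (\<lambda>_. B) (q * L) x"
proof -
  have "(1 - 2 * real r * b * (1 + d)) ^ q \<le> survival n D (q * L) x"
    using x small survival_block_ge D_periodic by (intro survival_periodic_ge) auto
  moreover have "survival n D (q * L) x - mean_hits n D' (q * L) x \<le>
      survival n (\<lambda>k. D k \<union> D' k) (q * L) x"
    by (intro survival_Un_ge n x D_subset)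
  moreover have "(\<lambda>k. D k \<union> D' k) = (\<lambda>_. B)" by (simp add: D_def D'_def fun_eq_iff)
  ultimately show ?thesis using mean_hits_gaps_le[OF x, of q] by simp
qed

end

section \<open>Survival as the law of the hitting time\<close>

text \<open>If \<open>B\<close> is entered at some time, the infimum is attained; otherwise both sides hold.\<close>

lemma hitting_time_ge_iff:
  "ereal_of_enat (hitting_time B y) \<ge> ereal s \<longleftrightarrow> (\<forall>k. real k < s \<longrightarrow> y k \<notin> B)"
proof (cases "\<exists>k. y k \<in> B")
  case True
  let ?S = "{enat k |k. y k \<in> B}"
  obtain k0 where "enat k0 \<in> ?S" using True by auto
  then have "Inf ?S \<in> ?S" by (rule wellorder_InfI)
  then obtain k where k: "Inf ?S = enat k" "y k \<in> B" by auto
  have least: "k \<le> j" if "y j \<in> B" for j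
  proof -
    have "Inf ?S \<le> enat j" using that by (intro Inf_lower) auto
    then show ?thesis using k by simp
  qed
  show ?thesis
  proof
    assume "ereal_of_enat (hitting_time B y) \<ge> ereal s"
    then show "\<forall>k. real k < s \<longrightarrow> y k \<notin> B" using least k by (force simp: hitting_time_def)
  next
    assume "\<forall>k. real k < s \<longrightarrow> y k \<notin> B"
    then show "ereal_of_enat (hitting_time B y) \<ge> ereal s" using k by (force simp: hitting_time_def)
  qed
next
  case False
  then have "{enat k |k. y k \<in> B} = {}" by auto
  then have "hitting_time B y = \<infinity>" unfolding hitting_time_def by (simp add: top_enat_def)
  then show ?thesis using False by simp
qed

text \<open>The conditions in \<open>simple_random_walk\<close> concern conditional probabilities given a whole
past path. The aim is to turn them into the recursion on the first step that defines
\<open>survival\<close>.\<close>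

locale random_walk = prob_space P for P :: "'w measure" +
  fixes n :: nat and x :: vertex and Y :: "nat \<Rightarrow> 'w \<Rightarrow> vertex"
  assumes walk: "simple_random_walk n x P Y" and n: "n \<ge> 1" and x: "x \<in> hypercube n"
begin

lemma Y_in_hypercube: "w \<in> space P \<Longrightarrow> Y k w \<in> hypercube n"
  using walk measurable_space[of "Y k" P "count_space (hypercube n)" w]
  unfolding simple_random_walk_def by auto

lemma Y_event: "{w \<in> space P. Q (Y k w)} \<in> events"
proof -
  have "Y k -` {y \<in> hypercube n. Q y} \<inter> space P \<in> events"
    using walk unfolding simple_random_walk_def by (intro measurable_sets[of _ _ "count_space (hypercube n)"]) auto
  also have "Y k -` {y \<in> hypercube n. Q y} \<inter> space P = {w \<in> space P. Q (Y k w)}"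
    using Y_in_hypercube by auto
  finally show ?thesis .
qed

lemma prefix_event: "{w \<in> space P. \<forall>j\<le>k. Y j w = ys j} \<in> events"
  using sets.sets_Collect_finite_All'[of "{..k}" P "\<lambda>j w. Y j w = ys j"] Y_event by simp

lemma avoid_event: "{w \<in> space P. \<forall>j\<in>{1..k}. Y j w \<notin> D j} \<in> events"
  using Y_event by (intro sets.sets_Collect_finite_All) auto

text \<open>Paths are extensional functions on the times \<open>0, ..., k\<close>, so that there are finitely
many of them and distinct ones describe disjoint events.\<close>

definition avoiding_paths :: "(nat \<Rightarrow> vertex set) \<Rightarrow> nat \<Rightarrow> (nat \<Rightarrow> vertex) set" where
  "avoiding_paths D k = {ys \<in> {..k} \<rightarrow>\<^sub>E hypercube n. \<forall>j\<in>{1..k}. ys j \<notin> D j}"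

lemma finite_avoiding_paths: "finite (avoiding_paths D k)"
  unfolding avoiding_paths_def by (intro finite_subset[OF _ finite_PiE[of "{..k}" "\<lambda>_. hypercube n"]]) auto

lemma prob_avoid_eq_sum_paths:
  assumes "{w \<in> space P. Q w} \<in> events"
  shows "\<P>(w in P. (\<forall>j\<in>{1..k}. Y j w \<notin> D j) \<and> Q w) =
    (\<Sum>ys\<in>avoiding_paths D k. \<P>(w in P. (\<forall>j\<le>k. Y j w = ys j) \<and> Q w))"
proof (rule prob_sum[OF finite_avoiding_paths])
  show "{w \<in> space P. (\<forall>j\<le>k. Y j w = ys j) \<and> Q w} \<in> events" for ys
    by (intro sets.sets_Collect_conj prefix_event assms)
  show "{w \<in> space P. (\<forall>j\<in>{1..k}. Y j w \<notin> D j) \<and> Q w} \<in> events"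
    by (intro sets.sets_Collect_conj avoid_event assms)
  show "AE w in P. (\<forall>ys\<in>avoiding_paths D k. (\<forall>j\<le>k. Y j w = ys j) \<and> Q w \<longrightarrow>
        (\<forall>j\<in>{1..k}. Y j w \<notin> D j) \<and> Q w) \<and>
      ((\<forall>j\<in>{1..k}. Y j w \<notin> D j) \<and> Q w \<longrightarrow>
        (\<exists>!ys\<in>avoiding_paths D k. (\<forall>j\<le>k. Y j w = ys j) \<and> Q w))"
  proof (intro AE_I2 conjI ballI impI)
    fix w assume w: "w \<in> space P" and a: "(\<forall>j\<in>{1..k}. Y j w \<notin> D j) \<and> Q w"
    let ?ys = "restrict (\<lambda>j. Y j w) {..k}"
    have mem: "?ys \<in> avoiding_paths D k"
      using a Y_in_hypercube[OF w] by (auto simp: avoiding_paths_def)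
    \<comment> \<open>Both functions are undefined beyond time \<open>k\<close>, so agreement up to \<open>k\<close> suffices.\<close>
    have unique: "ys = ?ys" if "ys \<in> avoiding_paths D k" "\<forall>j\<le>k. Y j w = ys j" for ys
      using that by (intro extensionalityI[of ys "{..k}"]) (auto simp: avoiding_paths_def PiE_iff)
    show "\<exists>!ys. ys \<in> avoiding_paths D k \<and> (\<forall>j\<le>k. Y j w = ys j) \<and> Q w"
    proof (rule ex1I)
      show "?ys \<in> avoiding_paths D k \<and> (\<forall>j\<le>k. Y j w = ?ys j) \<and> Q w"
        using mem a by simp
      show "ys = ?ys" if "ys \<in> avoiding_paths D k \<and> (\<forall>j\<le>k. Y j w = ys j) \<and> Q w" for ys
        using that unique by blast
    qed
  qed (auto simp: avoiding_paths_def)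
qed

text \<open>The defining condition of the walk gives this for paths of positive probability; for the
others both sides vanish.\<close>

lemma prob_path_step:
  assumes "y \<in> hypercube n"
  shows "\<P>(w in P. (\<forall>j\<le>k. Y j w = ys j) \<and> Y (Suc k) w = y) =
    \<P>(w in P. \<forall>j\<le>k. Y j w = ys j) * srw_step n (ys k) y"
proof (cases "\<P>(w in P. \<forall>j\<le>k. Y j w = ys j) > 0")
  case True
  then have "\<P>(w in P. Y (Suc k) w = y \<bar> \<forall>j\<le>k. Y j w = ys j) = srw_step n (ys k) y"
    using walk assms unfolding simple_random_walk_def by blast
  then show ?thesis using True by (simp add: cond_prob_def field_simps conj_commute)
next
  case False
  then have z: "\<P>(w in P. \<forall>j\<le>k. Y j w = ys j) = 0" using measure_nonneg[of P] by (simp add: less_le)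
  have "\<P>(w in P. (\<forall>j\<le>k. Y j w = ys j) \<and> Y (Suc k) w = y) \<le> \<P>(w in P. \<forall>j\<le>k. Y j w = ys j)"
    by (intro finite_measure_mono prefix_event) auto
  then show ?thesis using z measure_nonneg[of P "{w \<in> space P. (\<forall>j\<le>k. Y j w = ys j) \<and> Y (Suc k) w = y}"] by simp
qed

definition avoid_prob :: "(nat \<Rightarrow> vertex set) \<Rightarrow> nat \<Rightarrow> vertex \<Rightarrow> real" where
  "avoid_prob D k z = \<P>(w in P. (\<forall>j\<in>{1..k}. Y j w \<notin> D j) \<and> Y k w = z)"

lemma avoid_prob_eq_sum_paths:
  "avoid_prob D k z = (\<Sum>ys\<in>avoiding_paths D k. \<P>(w in P. \<forall>j\<le>k. Y j w = ys j) * of_bool (ys k = z))"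
proof -
  have "\<P>(w in P. (\<forall>j\<le>k. Y j w = ys j) \<and> Y k w = z) =
      \<P>(w in P. \<forall>j\<le>k. Y j w = ys j) * of_bool (ys k = z)" for ys
  proof (cases "ys k = z")
    case False
    then have "{w \<in> space P. (\<forall>j\<le>k. Y j w = ys j) \<and> Y k w = z} = {}" by auto
    then show ?thesis using False by (simp only: measure_empty) simp
  qed (auto intro!: arg_cong[of _ _ prob])
  then show ?thesis unfolding avoid_prob_def
    by (subst prob_avoid_eq_sum_paths[OF Y_event[of "\<lambda>y. y = z"]]) simp
qed

lemma avoid_prob_step:
  assumes y: "y \<in> hypercube n"
  shows "avoid_prob D (Suc k) y =
    (if y \<in> D (Suc k) then 0 else \<Sum>z\<in>hypercube n. avoid_prob D k z * srw_step n z y)"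
proof (cases "y \<in> D (Suc k)")
  case True
  then have "{w \<in> space P. (\<forall>j\<in>{1..Suc k}. Y j w \<notin> D j) \<and> Y (Suc k) w = y} = {}" by force
  then have "avoid_prob D (Suc k) y = 0" unfolding avoid_prob_def by (simp only: measure_empty)
  then show ?thesis using True by simp
next
  case False
  have "{w \<in> space P. (\<forall>j\<in>{1..Suc k}. Y j w \<notin> D j) \<and> Y (Suc k) w = y} =
      {w \<in> space P. (\<forall>j\<in>{1..k}. Y j w \<notin> D j) \<and> Y (Suc k) w = y}"
    using False by (auto simp: le_Suc_eq)
  then have "avoid_prob D (Suc k) y =
      (\<Sum>ys\<in>avoiding_paths D k. \<P>(w in P. \<forall>j\<le>k. Y j w = ys j) * srw_step n (ys k) y)"
    unfolding avoid_prob_def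
    by (simp add: prob_avoid_eq_sum_paths[OF Y_event[of "\<lambda>z. z = y"], simplified] prob_path_step[OF y])
  also have "\<dots> = (\<Sum>ys\<in>avoiding_paths D k. \<Sum>z\<in>hypercube n.
      \<P>(w in P. \<forall>j\<le>k. Y j w = ys j) * of_bool (ys k = z) * srw_step n z y)"
  proof (intro sum.cong refl)
    fix ys assume "ys \<in> avoiding_paths D k"
    then have "ys k \<in> hypercube n" by (auto simp: avoiding_paths_def)
    then have "(\<Sum>z\<in>hypercube n. c * of_bool (ys k = z) * srw_step n z y) = c * srw_step n (ys k) y" for c
      by (simp add: of_bool_def if_distrib[of "\<lambda>u. _ * u"] if_distrib[of "\<lambda>u. u * _"] cong: if_cong)
    then show "\<P>(w in P. \<forall>j\<le>k. Y j w = ys j) * srw_step n (ys k) y = (\<Sum>z\<in>hypercube n.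
      \<P>(w in P. \<forall>j\<le>k. Y j w = ys j) * of_bool (ys k = z) * srw_step n z y)" by simp
  qed
  also have "\<dots> = (\<Sum>z\<in>hypercube n. avoid_prob D k z * srw_step n z y)"
    by (subst sum.swap) (simp add: avoid_prob_eq_sum_paths sum_distrib_right)
  finally show ?thesis using False by simp
qed

lemma sum_avoid_prob:
  "(\<Sum>z\<in>hypercube n. avoid_prob D k z) = \<P>(w in P. \<forall>j\<in>{1..k}. Y j w \<notin> D j)"
  unfolding avoid_prob_def
  using Y_in_hypercube
  by (intro prob_sum[symmetric] avoid_event sets.sets_Collect_conj Y_event[of "\<lambda>y. y = _"]) auto

text \<open>The forward recursion for \<open>avoid_prob\<close> is dual to the backward recursion for \<open>survival\<close>:
their pairing at time \<open>k\<close> depends only on \<open>k + N\<close>. With \<open>k = 0\<close> it is a survival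
probability, and with \<open>N = 0\<close> the probability of an event of the process.\<close>

lemma sum_avoid_prob_survival:
  "(\<Sum>z\<in>hypercube n. avoid_prob D k z * survival n (\<lambda>j. D (j + k)) N z) =
    \<P>(w in P. \<forall>j\<in>{1..k + N}. Y j w \<notin> D j)"
proof (induction N arbitrary: k)
  case 0
  then show ?case by (simp only: survival.simps mult_1_right sum_avoid_prob add_0_right)
next
  case (Suc N)
  let ?s = "\<lambda>y. survival n (\<lambda>j. D (j + Suc k)) N y"
  let ?g = "\<lambda>y. if y \<in> D (Suc k) then 0 else ?s y"
  have eq: "(\<lambda>j. D (j + 1 + k)) = (\<lambda>j. D (j + Suc k))" by simp
  have "(\<Sum>z\<in>hypercube n. avoid_prob D k z * survival n (\<lambda>j. D (j + k)) (Suc N) z) =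
      (\<Sum>z\<in>hypercube n. avoid_prob D k z * (\<Sum>y\<in>hypercube n. srw_step n z y * ?g y))"
    by (intro sum.cong refl) (simp add: sum_srw_step eq cong: if_cong)
  also have "\<dots> = (\<Sum>y\<in>hypercube n. (\<Sum>z\<in>hypercube n. avoid_prob D k z * srw_step n z y) * ?g y)"
    unfolding sum_distrib_left sum_distrib_right by (subst sum.swap) (simp add: mult_ac)
  also have "\<dots> = (\<Sum>y\<in>hypercube n. avoid_prob D (Suc k) y * ?s y)"
    by (intro sum.cong refl) (simp add: avoid_prob_step)
  also have "\<dots> = \<P>(w in P. \<forall>j\<in>{1..Suc k + N}. Y j w \<notin> D j)" by (rule Suc)
  finally show ?case by simp
qed

lemma prob_avoid_eq_survival:
  "\<P>(w in P. \<forall>j\<in>{1..N}. Y j w \<notin> B) = survival n (\<lambda>_. B) N x"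
proof -
  have start: "AE w in P. Y 0 w = x" using walk by (simp add: simple_random_walk_def)
  have "avoid_prob D 0 z = of_bool (z = x)" for D z
  proof (cases "z = x")
    case True
    then have "AE w in P. Y 0 w = z" using start by simp
    then show ?thesis using True Y_event[of "\<lambda>y. y = z" 0] by (simp add: avoid_prob_def prob_Collect_eq_1)
  next
    case False
    then have "AE w in P. Y 0 w \<noteq> z" using start by auto
    then show ?thesis using False Y_event[of "\<lambda>y. y = z" 0] by (simp add: avoid_prob_def prob_Collect_eq_0)
  qed
  then have "survival n (\<lambda>_. B) N x =
      (\<Sum>z\<in>hypercube n. avoid_prob (\<lambda>_. B) 0 z * survival n (\<lambda>_. B) N z)"
    using x by (simp add: of_bool_def if_distrib[of "\<lambda>u. u * _"] cong: if_cong)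
  then show ?thesis using sum_avoid_prob_survival[of "\<lambda>_. B" 0 N] by simp
qed

text \<open>The number of steps to be survived is \<open>nat \<lceil>s\<rceil> - 1\<close>: this is the largest natural number
below \<open>s\<close> for \<open>s > 0\<close>, and the time \<open>0\<close> is harmless because the walk starts outside \<open>B\<close>.\<close>

lemma prob_hitting_time_ge:
  assumes "x \<notin> B"
  shows "\<P>(w in P. ereal_of_enat (hitting_time B (\<lambda>k. Y k w)) \<ge> ereal s) =
    survival n (\<lambda>_. B) (nat \<lceil>s\<rceil> - 1) x"
proof -
  let ?N = "nat \<lceil>s\<rceil> - 1"
  have Q: "{w \<in> space P. \<forall>k. real k < s \<longrightarrow> Y k w \<notin> B} \<in> events"
    using Y_event by (intro sets.sets_Collect_countable_All sets.sets_Collect_imp sets.sets_Collect_const) auto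
  have "AE w in P. (\<forall>k. real k < s \<longrightarrow> Y k w \<notin> B) \<longleftrightarrow> (\<forall>j\<in>{1..?N}. Y j w \<notin> B)"
  proof -
    have "AE w in P. Y 0 w = x" using walk by (simp add: simple_random_walk_def)
    then show ?thesis
    proof (eventually_elim, intro iffI ballI allI impI)
      fix w k assume w: "Y 0 w = x" "\<forall>j\<in>{1..?N}. Y j w \<notin> B" and k: "real k < s"
      show "Y k w \<notin> B"
      proof (cases "k = 0")
        case False
        have "int k < \<lceil>s\<rceil>" using k by (simp add: less_ceiling_iff)
        then have "k \<in> {1..?N}" using False by auto
        then show ?thesis using w by blast
      qed (use w assms in simp)
    next
      fix w j assume "\<forall>k. real k < s \<longrightarrow> Y k w \<notin> B" "j \<in> {1..?N}"
      moreover from \<open>j \<in> {1..?N}\<close> have "int j < \<lceil>s\<rceil>" by auto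
      then have "real j < s" by (simp add: less_ceiling_iff)
      ultimately show "Y j w \<notin> B" by blast
    qed
  qed
  then have "\<P>(w in P. \<forall>k. real k < s \<longrightarrow> Y k w \<notin> B) = \<P>(w in P. \<forall>j\<in>{1..?N}. Y j w \<notin> B)"
    by (intro prob_eq_AE Q avoid_event)
  then show ?thesis by (simp only: hitting_time_ge_iff prob_avoid_eq_survival)
qed

end

section \<open>Expected visits to a uniformly random set\<close>

lemma finite_k_subsets: "finite V \<Longrightarrow> finite (k_subsets V k)"
  by (simp add: k_subsets_def)

lemma card_k_subsets: "finite V \<Longrightarrow> card (k_subsets V k) = card V choose k"
  by (simp add: k_subsets_def n_subsets)

lemma card_k_subsets_containing:
  assumes "finite V" "S \<subseteq> V"
  shows "card {B \<in> k_subsets V k. S \<subseteq> B} = (if card S \<le> k then (card V - card S) choose (k - card S) else 0)"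
proof (cases "card S \<le> k")
  case True
  have fS: "finite S" using assms finite_subset by blast
  have "bij_betw (\<lambda>B. B - S) {B \<in> k_subsets V k. S \<subseteq> B} (k_subsets (V - S) (k - card S))"
  proof (rule bij_betw_byWitness[where f' = "\<lambda>B. B \<union> S"])
    show "(\<lambda>B. B - S) ` {B \<in> k_subsets V k. S \<subseteq> B} \<subseteq> k_subsets (V - S) (k - card S)"
      using fS by (auto simp: k_subsets_def card_Diff_subset)
    show "(\<lambda>B. B \<union> S) ` k_subsets (V - S) (k - card S) \<subseteq> {B \<in> k_subsets V k. S \<subseteq> B}"
    proof safe
      fix B assume "B \<in> k_subsets (V - S) (k - card S)"
      then have B: "B \<subseteq> V - S" "card B = k - card S" by (auto simp: k_subsets_def)
      then have "finite B" using assms(1) by (auto intro: finite_subset)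
      then have "card (B \<union> S) = card B + card S" using B fS by (intro card_Un_disjoint) auto
      then show "B \<union> S \<in> k_subsets V k" using B True assms(2) by (auto simp: k_subsets_def)
    qed
  qed (auto simp: k_subsets_def)
  then have "card {B \<in> k_subsets V k. S \<subseteq> B} = card (k_subsets (V - S) (k - card S))"
    by (rule bij_betw_same_card)
  then show ?thesis using True assms fS by (simp add: card_k_subsets card_Diff_subset)
next
  case False
  have "card S \<le> k" if "B \<in> k_subsets V k" "S \<subseteq> B" for B
    using that assms(1) card_mono[of B S] by (auto simp: k_subsets_def intro: finite_subset)
  then have "{B \<in> k_subsets V k. S \<subseteq> B} = {}" using False by auto
  then show ?thesis using False by (simp only: card.empty if_False)
qed

text \<open>The probability that a uniformly random \<open>k\<close>-subset of \<open>N\<close> points contains \<open>s\<close> given points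
is at most what it would be if points were included independently with probability
\<open>k / N\<close>.\<close>

lemma binomial_minus_le:
  assumes "s \<le> k" "k \<le> N"
  shows "real ((N - s) choose (k - s)) \<le> (real k / real N) ^ s * real (N choose k)"
  using assms(1)
proof (induction s)
  case (Suc s)
  have N: "N - s > 0" "k - s > 0" "N > 0" using Suc.prems assms(2) by auto
  have "real (N - s) * real ((N - Suc s) choose (k - Suc s)) = real (k - s) * real ((N - s) choose (k - s))"
    using times_binomial_minus1_eq[OF N(2), of "N - s"] by (simp flip: of_nat_mult)
  then have "real ((N - Suc s) choose (k - Suc s)) =
      real (k - s) / real (N - s) * real ((N - s) choose (k - s))"
    using N by (simp add: field_simps)
  also have "\<dots> \<le> real k / real N * ((real k / real N) ^ s * real (N choose k))"
  proof (intro mult_mono)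
    have "real s * real k \<le> real s * real N" using assms(2) by (intro mult_left_mono) auto
    then show "real (k - s) / real (N - s) \<le> real k / real N"
      using N Suc.prems assms(2) by (simp add: field_simps of_nat_diff)
    show "real ((N - s) choose (k - s)) \<le> (real k / real N) ^ s * real (N choose k)"
      using Suc by simp
  qed auto
  finally show ?case by (simp add: mult_ac)
qed simp

text \<open>Sampling without replacement is dominated by independent sampling for products of factors
at least \<open>1\<close>: expand the products into monomials with nonnegative coefficients, and
compare the inclusion probabilities one by one.\<close>

lemma sum_k_subsets_prod_le:
  fixes u :: "'a \<Rightarrow> real"
  assumes "finite V" "k \<le> card V" "\<And>y. y \<in> V \<Longrightarrow> 0 \<le> u y"
  shows "(\<Sum>B\<in>k_subsets V k. \<Prod>y\<in>B. 1 + u y) \<le>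
    real (card V choose k) * (\<Prod>y\<in>V. 1 + real k / real (card V) * u y)"
proof -
  let ?K = "k_subsets V k" and ?p = "real k / real (card V)"
  have fin: "finite B" "B \<subseteq> V" if "B \<in> ?K" for B
    using that assms(1) by (auto simp: k_subsets_def intro: finite_subset)
  have "(\<Sum>B\<in>?K. \<Prod>y\<in>B. 1 + u y) = (\<Sum>B\<in>?K. \<Sum>S\<in>Pow B. \<Prod>y\<in>S. u y)"
    by (intro sum.cong refl) (simp add: sum_Pow_prod fin)
  also have "\<dots> = (\<Sum>B\<in>?K. \<Sum>S\<in>Pow V. if S \<subseteq> B then \<Prod>y\<in>S. u y else 0)"
  proof (rule sum.cong[OF refl])
    fix B assume "B \<in> ?K"
    then have "Pow B = {S \<in> Pow V. S \<subseteq> B}" using fin by auto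
    then show "(\<Sum>S\<in>Pow B. \<Prod>y\<in>S. u y) = (\<Sum>S\<in>Pow V. if S \<subseteq> B then \<Prod>y\<in>S. u y else 0)"
      using assms(1) by (simp only: sum.inter_filter finite_Pow_iff)
  qed
  also have "\<dots> = (\<Sum>S\<in>Pow V. \<Sum>B\<in>?K. if S \<subseteq> B then \<Prod>y\<in>S. u y else 0)"
    by (rule sum.swap)
  also have "\<dots> = (\<Sum>S\<in>Pow V. real (card {B \<in> ?K. S \<subseteq> B}) * (\<Prod>y\<in>S. u y))"
    using assms(1) by (intro sum.cong refl) (simp add: sum.inter_filter[symmetric] finite_k_subsets)
  also have "\<dots> \<le> (\<Sum>S\<in>Pow V. ?p ^ card S * real (card V choose k) * (\<Prod>y\<in>S. u y))"
  proof (intro sum_mono mult_right_mono)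
    fix S assume S: "S \<in> Pow V"
    show "0 \<le> (\<Prod>y\<in>S. u y)" using S assms(3) by (intro prod_nonneg) auto
    show "real (card {B \<in> ?K. S \<subseteq> B}) \<le> ?p ^ card S * real (card V choose k)"
      using S card_k_subsets_containing[OF assms(1), of S k] binomial_minus_le[of "card S" k "card V"] assms(2)
      by auto
  qed
  also have "\<dots> = real (card V choose k) * (\<Sum>S\<in>Pow V. \<Prod>y\<in>S. ?p * u y)"
    unfolding sum_distrib_left prod.distrib by (intro sum.cong refl) simp
  also have "\<dots> = real (card V choose k) * (\<Prod>y\<in>V. 1 + ?p * u y)"
    by (simp only: sum_Pow_prod[OF assms(1)])
  finally show ?thesis .
qed

text \<open>The exponential Markov inequality for sampling without replacement. On \<open>[0, \<theta> * c]\<close> the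
convex function \<open>exp u - 1\<close> is at most \<open>u * exp (\<theta> * c)\<close>, so the exponent is
linear in the mean of the sum.\<close>

lemma chernoff_k_subsets:
  fixes w :: "'a \<Rightarrow> real"
  assumes "finite V" "k \<le> card V" "\<And>y. y \<in> V \<Longrightarrow> 0 \<le> w y" "\<And>y. y \<in> V \<Longrightarrow> w y \<le> c" "0 \<le> \<theta>"
  shows "real (card {B \<in> k_subsets V k. (\<Sum>y\<in>B. w y) > \<epsilon>}) \<le>
    real (card V choose k) * exp (\<theta> * exp (\<theta> * c) * (real k / real (card V)) * (\<Sum>y\<in>V. w y) - \<theta> * \<epsilon>)"
proof -
  let ?K = "k_subsets V k" and ?p = "real k / real (card V)"
  let ?u = "\<lambda>y. exp (\<theta> * w y) - 1"
  have u: "0 \<le> ?u y" "?u y \<le> \<theta> * w y * exp (\<theta> * c)" if y: "y \<in> V" for y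
  proof -
    have v: "0 \<le> \<theta> * w y" "\<theta> * w y \<le> \<theta> * c" using assms y by (auto intro: mult_left_mono)
    have "1 - \<theta> * w y \<le> exp (- (\<theta> * w y))" using exp_ge_add_one_self[of "- (\<theta> * w y)"] by simp
    then have "(1 - \<theta> * w y) * exp (\<theta> * w y) \<le> exp (- (\<theta> * w y)) * exp (\<theta> * w y)"
      by (intro mult_right_mono) auto
    then have "?u y \<le> \<theta> * w y * exp (\<theta> * w y)" by (simp add: exp_minus algebra_simps)
    also have "\<dots> \<le> \<theta> * w y * exp (\<theta> * c)" using v by (intro mult_left_mono) auto
    finally show "?u y \<le> \<theta> * w y * exp (\<theta> * c)" .
    show "0 \<le> ?u y" using v by simp
  qed
  have "real (card {B \<in> ?K. (\<Sum>y\<in>B. w y) > \<epsilon>}) * exp (\<theta> * \<epsilon>) = (\<Sum>B\<in>{B \<in> ?K. (\<Sum>y\<in>B. w y) > \<epsilon>}. exp (\<theta> * \<epsilon>))"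
    by simp
  also have "\<dots> \<le> (\<Sum>B\<in>{B \<in> ?K. (\<Sum>y\<in>B. w y) > \<epsilon>}. exp (\<theta> * (\<Sum>y\<in>B. w y)))"
    using assms(5) by (intro sum_mono) (auto intro!: mult_left_mono)
  also have "\<dots> \<le> (\<Sum>B\<in>?K. exp (\<theta> * (\<Sum>y\<in>B. w y)))"
    using assms(1) by (intro sum_mono2) (auto simp: finite_k_subsets)
  also have "\<dots> = (\<Sum>B\<in>?K. \<Prod>y\<in>B. 1 + ?u y)"
  proof (rule sum.cong[OF refl])
    fix B assume "B \<in> ?K"
    then have "finite B" using assms(1) by (auto simp: k_subsets_def intro: finite_subset)
    then show "exp (\<theta> * (\<Sum>y\<in>B. w y)) = (\<Prod>y\<in>B. 1 + ?u y)"
      by (simp add: sum_distrib_left exp_sum)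
  qed
  also have "\<dots> \<le> real (card V choose k) * (\<Prod>y\<in>V. 1 + ?p * ?u y)"
    using assms(1,2) u by (intro sum_k_subsets_prod_le) auto
  also have "\<dots> \<le> real (card V choose k) * (\<Prod>y\<in>V. exp (?p * (\<theta> * w y * exp (\<theta> * c))))"
  proof (intro mult_left_mono prod_mono conjI)
    fix y assume y: "y \<in> V"
    show "0 \<le> 1 + ?p * ?u y" using u(1)[OF y] by (intro add_nonneg_nonneg mult_nonneg_nonneg) auto
    have "?p * ?u y \<le> ?p * (\<theta> * w y * exp (\<theta> * c))" using u(2)[OF y] by (intro mult_left_mono) auto
    then show "1 + ?p * ?u y \<le> exp (?p * (\<theta> * w y * exp (\<theta> * c)))"
      using exp_ge_add_one_self[of "?p * (\<theta> * w y * exp (\<theta> * c))"] by linarith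
  qed auto
  also have "(\<Prod>y\<in>V. exp (?p * (\<theta> * w y * exp (\<theta> * c)))) =
      exp (\<theta> * exp (\<theta> * c) * ?p * (\<Sum>y\<in>V. w y))"
    unfolding exp_sum[OF assms(1), symmetric] sum_distrib_left by (simp add: mult_ac)
  finally show ?thesis by (simp add: exp_diff field_simps)
qed

lemma mean_hits_const:
  "mean_hits n (\<lambda>_. B) L x = (\<Sum>y\<in>B. \<Sum>k=1..L. transition n k x y)"
  unfolding mean_hits_def by (rule sum.swap)

text \<open>The bound \<open>1/n\<close> for each of the first five steps and \<open>O(1/n\<^sup>3)\<close> for the \<open>O(n\<^sup>2)\<close> other
ones.\<close>

lemma sum_transition_time_le:
  assumes "n \<ge> 1" "x \<in> hypercube n" "y \<in> hypercube n" "L \<le> 3 * n\<^sup>2"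
  shows "(\<Sum>k=1..L. transition n k x y) \<le> 1000000 / real n"
proof -
  have "real L \<le> real (3 * n\<^sup>2)" using assms(4) by (simp only: of_nat_le_iff)
  then have L: "real L \<le> 3 * real n ^ 2" by simp
  have le: "transition n k x y \<le> (if k \<le> 5 then 1 / real n else 0) + 300000 / real n ^ 3" if "k \<in> {1..L}" for k
    using transition_le_inverse_dim[OF assms(1-3), of k] transition_le_inverse_dim_cubed[OF assms(1-3), of k] that
    by (cases "k \<le> 5") (auto intro: order_trans)
  have "(\<Sum>k=1..L. transition n k x y) \<le> (\<Sum>k=1..L. (if k \<le> 5 then 1 / real n else 0) + 300000 / real n ^ 3)"
    by (intro sum_mono le)
  also have "\<dots> = (\<Sum>k\<in>{1..L}. if k \<in> {1..5} then 1 / real n else 0) + real L * (300000 / real n ^ 3)"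
    unfolding sum.distrib by (intro arg_cong2[where f = "(+)"] sum.cong) auto
  also have "(\<Sum>k\<in>{1..L}. if k \<in> {1..5} then 1 / real n else 0) \<le> (\<Sum>k\<in>{1..5::nat}. 1 / real n)"
    by (subst sum.inter_restrict[symmetric]) (auto intro!: divide_right_mono)
  also have "real L * (300000 / real n ^ 3) \<le> 3 * real n ^ 2 * (300000 / real n ^ 3)"
    by (intro mult_right_mono L) simp
  also have "(\<Sum>k\<in>{1..5::nat}. 1 / real n) + 3 * real n ^ 2 * (300000 / real n ^ 3) \<le> 1000000 / real n"
    using assms(1) by (simp add: field_simps power2_eq_square power3_eq_cube)
  finally show ?thesis by simp
qed

text \<open>The Chernoff parameter \<open>3 * n / \<epsilon>\<close> makes the deviation cost \<open>exp (- 3 * n)\<close>. Since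
the weights are \<open>O(1/n)\<close>, their exponentials stay bounded, and \<open>small\<close> says that the mean
contributes at most \<open>exp n\<close>. The union bound over starting points costs another
\<open>2 ^ n <= exp n\<close>.\<close>

lemma card_many_hits_le:
  assumes "n \<ge> 1" "M \<le> 2 ^ n" "L \<le> 3 * n\<^sup>2" "\<epsilon> > 0"
    and small: "3 / \<epsilon> * exp (3000000 / \<epsilon>) * (real L * real M / 2 ^ n) \<le> 1"
  shows "real (card {B \<in> k_subsets (hypercube n) M. \<exists>x\<in>hypercube n. mean_hits n (\<lambda>_. B) L x > \<epsilon>}) \<le>
    real (card (k_subsets (hypercube n) M)) * exp (- real n)"
proof -
  let ?K = "k_subsets (hypercube n) M"
  let ?C = "real (card ?K)"
  have one: "real (card {B \<in> ?K. mean_hits n (\<lambda>_. B) L x > \<epsilon>}) \<le> ?C * exp (- 2 * real n)"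
    if x: "x \<in> hypercube n" for x
  proof -
    let ?w = "\<lambda>y. \<Sum>k=1..L. transition n k x y" and ?\<theta> = "3 * real n / \<epsilon>"
    have tot: "(\<Sum>y\<in>hypercube n. ?w y) = real L"
      by (subst sum.swap) (simp add: sum_transition[OF assms(1) x])
    have "real (card {B \<in> ?K. (\<Sum>y\<in>B. ?w y) > \<epsilon>}) \<le> real (card (hypercube n) choose M) *
        exp (?\<theta> * exp (?\<theta> * (1000000 / real n)) * (real M / real (card (hypercube n))) *
          (\<Sum>y\<in>hypercube n. ?w y) - ?\<theta> * \<epsilon>)"
      using assms x by (intro chernoff_k_subsets sum_transition_time_le sum_nonneg transition_nonneg)
        (auto simp: card_hypercube)
    also have "?\<theta> * exp (?\<theta> * (1000000 / real n)) * (real M / real (card (hypercube n))) *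
          (\<Sum>y\<in>hypercube n. ?w y) - ?\<theta> * \<epsilon> =
        real n * (3 / \<epsilon> * exp (3000000 / \<epsilon>) * (real L * real M / 2 ^ n)) - 3 * real n"
      unfolding tot using assms(1,4) by (simp add: card_hypercube mult_ac)
    also have "exp \<dots> \<le> exp (- 2 * real n)"
      using mult_left_mono[OF small, of "real n"] by simp
    finally show ?thesis
      by (simp add: mean_hits_const card_k_subsets mult_left_mono)
  qed
  have "{B \<in> ?K. \<exists>x\<in>hypercube n. mean_hits n (\<lambda>_. B) L x > \<epsilon>} =
      (\<Union>x\<in>hypercube n. {B \<in> ?K. mean_hits n (\<lambda>_. B) L x > \<epsilon>})" by auto
  then have "real (card {B \<in> ?K. \<exists>x\<in>hypercube n. mean_hits n (\<lambda>_. B) L x > \<epsilon>}) \<le>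
      real (\<Sum>x\<in>hypercube n. card {B \<in> ?K. mean_hits n (\<lambda>_. B) L x > \<epsilon>})"
    using card_UN_le[OF finite_hypercube] by (simp only: of_nat_le_iff)
  also have "\<dots> \<le> (\<Sum>x\<in>hypercube n. ?C * exp (- 2 * real n))"
    unfolding of_nat_sum by (intro sum_mono one)
  also have "\<dots> = ?C * (2 ^ n * exp (- 2 * real n))" by (simp add: card_hypercube)
  also have "\<dots> \<le> ?C * (exp 1 ^ n * exp (- 2 * real n))"
    using exp_ge_add_one_self[of 1] by (intro mult_left_mono mult_right_mono power_mono) auto
  also have "exp 1 ^ n * exp (- 2 * real n) = exp (- real n)"
    by (simp add: exp_of_nat_mult[symmetric] exp_add[symmetric])
  finally show ?thesis .
qed

lemma AE_mean_hits_small: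
  fixes A :: "nat \<Rightarrow> 'o \<Rightarrow> vertex set" and M L :: "nat \<Rightarrow> nat"
  assumes P': "prob_space P'"
    and A_measurable: "\<And>n. n \<ge> 1 \<Longrightarrow>
      A n \<in> measurable P' (count_space (k_subsets (hypercube n) (M n)))"
    and A_uniform: "\<And>n. n \<ge> 1 \<Longrightarrow>
      distr P' (count_space (k_subsets (hypercube n) (M n))) (A n) =
      uniform_count_measure (k_subsets (hypercube n) (M n))"
    and L: "eventually (\<lambda>n. L n \<le> 3 * n\<^sup>2) sequentially"
    and LM: "(\<lambda>n. real (L n) * real (M n) / 2 ^ n) \<longlonglongrightarrow> 0"
  shows "AE \<omega> in P'. \<forall>\<epsilon>>0. \<forall>\<^sub>F n in sequentially.
    \<forall>x\<in>hypercube n. mean_hits n (\<lambda>_. A n \<omega>) (L n) x \<le> \<epsilon>"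
proof -
  interpret prob_space P' by (rule P')
  let ?K = "\<lambda>n. k_subsets (hypercube n) (M n)"
  have AE_eps: "AE \<omega> in P'. \<forall>\<^sub>F n in sequentially.
    \<forall>x\<in>hypercube n. mean_hits n (\<lambda>_. A n \<omega>) (L n) x \<le> \<epsilon>" if \<epsilon>: "\<epsilon> > 0" for \<epsilon> :: real
  proof -
    define bad where "bad n = {B \<in> ?K n. \<exists>x\<in>hypercube n. mean_hits n (\<lambda>_. B) (L n) x > \<epsilon>}" for n
    \<comment> \<open>The case \<open>n = 0\<close> is set aside, since nothing is known about \<open>A 0\<close>.\<close>
    define E where "E n = (if n = 0 then {} else A n -` bad n \<inter> space P')" for n
    have E: "E n \<in> events" for n
      using measurable_sets[OF A_measurable, of n "bad n"] by (auto simp: E_def bad_def)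
    have "(\<lambda>n. 3 / \<epsilon> * exp (3000000 / \<epsilon>) * (real (L n) * real (M n) / 2 ^ n)) \<longlonglongrightarrow>
        3 / \<epsilon> * exp (3000000 / \<epsilon>) * 0" by (intro tendsto_mult_left LM)
    then have "\<forall>\<^sub>F n in sequentially. 3 / \<epsilon> * exp (3000000 / \<epsilon>) * (real (L n) * real (M n) / 2 ^ n) < 1"
      by (rule order_tendstoD) simp
    with L eventually_ge_at_top[of 1]
    have "\<forall>\<^sub>F n in sequentially. norm (prob (E n)) \<le> exp (- 1) ^ n"
    proof eventually_elim
      case (elim n)
      have ne: "?K n \<noteq> {}" using measurable_space[OF A_measurable[OF elim(2)]] not_empty by auto
      then obtain B where "B \<subseteq> hypercube n" "card B = M n" by (auto simp: k_subsets_def)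
      then have M: "M n \<le> 2 ^ n"
        using card_mono[OF finite_hypercube[of n], of B] by (simp add: card_hypercube)
      have cpos: "card (?K n) > 0" using ne finite_k_subsets[of "hypercube n"] by (simp add: card_gt_0_iff)
      have "prob (E n) = measure (distr P' (count_space (?K n)) (A n)) (bad n)"
        using elim by (subst measure_distr[OF A_measurable]) (auto simp: E_def bad_def)
      also have "\<dots> = real (card (bad n)) / real (card (?K n))"
        unfolding A_uniform[OF elim(2)]
        by (rule measure_uniform_count_measure) (auto simp: finite_k_subsets bad_def)
      also have "\<dots> \<le> exp (- real n)"
        using card_many_hits_le[OF elim(2) M elim(1) \<epsilon>] elim(3) cpos
        by (simp add: bad_def field_simps)
      also have "\<dots> = exp (- 1) ^ n" by (simp add: exp_of_nat_mult[symmetric])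
      finally show ?case by simp
    qed
    then have "summable (\<lambda>n. prob (E n))"
      by (rule summable_comparison_test_ev) (simp add: summable_geometric)
    then have "AE \<omega> in P'. \<forall>\<^sub>F n in sequentially. \<omega> \<in> space P' - E n"
      by (intro borel_cantelli_AE1 E) (auto simp: emeasure_eq_measure)
    then show ?thesis
    proof (eventually_elim)
      case (elim \<omega>)
      from elim eventually_ge_at_top[of 1] show ?case
      proof eventually_elim
        case (elim n)
        then have "A n \<omega> \<in> ?K n" using measurable_space[OF A_measurable[OF elim(2)]] by auto
        then show ?case using elim by (auto simp: E_def bad_def not_less)
      qed
    qed
  qed
  have "AE \<omega> in P'. \<forall>i. \<forall>\<^sub>F n in sequentially.
      \<forall>x\<in>hypercube n. mean_hits n (\<lambda>_. A n \<omega>) (L n) x \<le> 1 / real (Suc i)"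
    by (subst AE_all_countable) (auto intro!: AE_eps)
  then show ?thesis
  proof (eventually_elim, intro allI impI)
    fix \<omega> \<epsilon>
    assume *: "\<forall>i. \<forall>\<^sub>F n in sequentially.
      \<forall>x\<in>hypercube n. mean_hits n (\<lambda>_. A n \<omega>) (L n) x \<le> 1 / real (Suc i)" and "(0::real) < \<epsilon>"
    then obtain i where "1 / real (Suc i) < \<epsilon>" using nat_approx_posE by blast
    with * show "\<forall>\<^sub>F n in sequentially. \<forall>x\<in>hypercube n. mean_hits n (\<lambda>_. A n \<omega>) (L n) x \<le> \<epsilon>"
      by (auto elim!: allE[of _ i] eventually_mono intro: order_trans)
  qed
qed

section \<open>Choice of scales and passage to the limit\<close>

text \<open>With \<open>c = n ln n\<close>, the geometric mean \<open>sqrt (c * m)\<close> lies strictly between the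
scales \<open>c\<close> and \<open>m\<close>. It is capped at \<open>n\<^sup>2\<close>, which is still much larger than \<open>c\<close>, because
the kernel estimates are summed over \<open>O(n\<^sup>2)\<close> steps.\<close>

lemma exists_block_lengths:
  fixes m :: "nat \<Rightarrow> real"
  assumes pos: "\<And>n. n \<ge> 1 \<Longrightarrow> m n > 0"
    and lower: "(\<lambda>n. real n * ln (real n) / m n) \<longlonglongrightarrow> 0"
  obtains t r :: "nat \<Rightarrow> nat" where
    "\<And>n. real (t n) \<ge> real n * ln (real n)" "eventually (\<lambda>n. r n \<ge> 1) sequentially"
    "eventually (\<lambda>n. t n + 2 * r n \<le> 3 * n\<^sup>2) sequentially"
    "(\<lambda>n. real (t n) / real (r n)) \<longlonglongrightarrow> 0" "(\<lambda>n. real (r n) / m n) \<longlonglongrightarrow> 0"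
proof -
  define c where "c n = real n * ln (real n)" for n
  define s where "s n = min (sqrt (c n * m n)) (real n ^ 2)" for n
  define t where "t n = nat \<lceil>c n\<rceil>" for n
  define r where "r n = nat \<lfloor>s n\<rfloor>" for n
  have cm: "(\<lambda>n. c n / m n) \<longlonglongrightarrow> 0" using lower by (simp add: c_def)
  have c_top: "filterlim c at_top sequentially" unfolding c_def by real_asymp
  have c1: "eventually (\<lambda>n. c n \<ge> 1) sequentially" using c_top by (simp add: filterlim_at_top)
  have m_gt: "eventually (\<lambda>n. c n \<le> m n) sequentially"
    using order_tendstoD(2)[OF cm zero_less_one] eventually_ge_at_top[of 1]
    by eventually_elim (use pos in \<open>auto simp: field_simps\<close>)
  have s_ge: "eventually (\<lambda>n. s n \<ge> c n) sequentially"
    using m_gt c1 eventually_ge_at_top[of 1]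
  proof eventually_elim
    case (elim n)
    have "c n * c n \<le> c n * m n" using elim by (intro mult_left_mono) auto
    then have "c n \<le> sqrt (c n * m n)" using elim by (intro real_le_rsqrt) (simp add: power2_eq_square)
    moreover have "c n \<le> real n * real n"
      unfolding c_def using ln_le_minus_one[of "real n"] elim by (intro mult_left_mono) auto
    ultimately show ?case by (simp add: s_def power2_eq_square)
  qed
  have s_top: "filterlim s at_top sequentially"
    by (rule filterlim_at_top_mono[OF c_top s_ge])
  have s2: "eventually (\<lambda>n. s n \<ge> 2) sequentially" using s_top by (simp add: filterlim_at_top)
  have r_ge: "real (r n) \<ge> s n / 2" if "s n \<ge> 2" for n
    using that unfolding r_def by linarith
  have r_le: "real (r n) \<le> s n" if "s n \<ge> 0" for n
    using that unfolding r_def by linarith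
  have t_le: "real (t n) \<le> c n + 1" if "c n \<ge> 0" for n
    using that unfolding t_def by linarith
  show ?thesis
  proof (rule that[of t r])
    show "real (t n) \<ge> real n * ln (real n)" for n unfolding t_def c_def by linarith
    show "eventually (\<lambda>n. r n \<ge> 1) sequentially"
      using s2
    proof eventually_elim
      case (elim n)
      then show ?case using r_ge[of n] by linarith
    qed
    show "eventually (\<lambda>n. t n + 2 * r n \<le> 3 * n\<^sup>2) sequentially"
      using s2 c1 eventually_ge_at_top[of 1]
    proof eventually_elim
      case (elim n)
      have "c n \<le> real n * (real n - 1)"
        unfolding c_def using ln_le_minus_one[of "real n"] elim by (intro mult_left_mono) auto
      also have "\<dots> + 1 \<le> real n ^ 2" using elim by (simp add: algebra_simps power2_eq_square)
      finally have "real (t n) \<le> real n ^ 2" using t_le[of n] elim by linarith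
      moreover have "s n \<le> real n ^ 2" by (simp add: s_def)
      then have "real (r n) \<le> real n ^ 2" using r_le[of n] elim by linarith
      ultimately have "t n \<le> n\<^sup>2" "r n \<le> n\<^sup>2" by (simp_all only: of_nat_le_iff flip: of_nat_power)
      then show ?case by linarith
    qed
    have sq: "(\<lambda>n. sqrt (c n / m n)) \<longlonglongrightarrow> 0" using tendsto_real_sqrt[OF cm] by simp
    show "(\<lambda>n. real (r n) / m n) \<longlonglongrightarrow> 0"
    proof (rule tendsto_sandwich[OF _ _ tendsto_const sq])
      show "eventually (\<lambda>n. 0 \<le> real (r n) / m n) sequentially"
        using eventually_ge_at_top[of 1] by eventually_elim (use pos in \<open>simp add: less_imp_le\<close>)
      show "eventually (\<lambda>n. real (r n) / m n \<le> sqrt (c n / m n)) sequentially"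
        using eventually_ge_at_top[of 1] s2
      proof eventually_elim
        case (elim n)
        have "s n \<le> sqrt (c n * m n)" by (simp add: s_def)
        then have "real (r n) \<le> sqrt (c n * m n)" using r_le[of n] elim by linarith
        then have "real (r n) / m n \<le> sqrt (c n * m n) / m n"
          using elim pos[of n] by (intro divide_right_mono) auto
        also have "\<dots> = sqrt (c n / m n)"
          using pos[of n] elim by (simp add: real_sqrt_mult real_sqrt_divide field_simps)
        finally show ?case .
      qed
    qed
    have "(\<lambda>n. 4 * (sqrt (c n / m n) + ln (real n) / real n)) \<longlonglongrightarrow> 4 * (0 + 0)"
      by (intro tendsto_mult tendsto_add tendsto_const sq) real_asymp
    then have lim: "(\<lambda>n. 4 * (sqrt (c n / m n) + ln (real n) / real n)) \<longlonglongrightarrow> 0" by simp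
    show "(\<lambda>n. real (t n) / real (r n)) \<longlonglongrightarrow> 0"
    proof (rule tendsto_sandwich[OF _ _ tendsto_const lim])
      show "eventually (\<lambda>n. real (t n) / real (r n) \<le> 4 * (sqrt (c n / m n) + ln (real n) / real n)) sequentially"
        using eventually_ge_at_top[of 1] s2 c1
      proof eventually_elim
        case (elim n)
        have m: "m n > 0" using pos elim by simp
        have cs: "c n / s n \<le> sqrt (c n / m n) + ln (real n) / real n"
        proof (cases "s n = real n ^ 2")
          case True
          then have "c n / s n = ln (real n) / real n" using elim by (simp add: c_def power2_eq_square)
          moreover have "0 \<le> sqrt (c n / m n)" using m elim by simp
          ultimately show ?thesis by simp
        next
          case False
          then have "s n = sqrt (c n * m n)" by (simp add: s_def min_def split: if_splits)
          moreover have "c n / sqrt (c n * m n) = sqrt (c n / m n)"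
            using m elim by (simp add: real_sqrt_mult real_sqrt_divide field_simps)
          moreover have "0 \<le> ln (real n) / real n" using elim by simp
          ultimately show ?thesis by simp
        qed
        have "real (t n) / real (r n) \<le> (2 * c n) / (s n / 2)"
          using t_le[of n] r_ge[of n] elim by (intro frac_le) auto
        also have "\<dots> = 4 * (c n / s n)" by simp
        also have "\<dots> \<le> 4 * (sqrt (c n / m n) + ln (real n) / real n)" using cs by simp
        finally show ?case .
      qed
    qed simp
  qed
qed

text \<open>The bounds over full blocks, put into exponential form and extended to a time \<open>N\<close> that is
not a multiple of the block length, for a density that is only known to lie between \<open>bl\<close>
and \<open>bh\<close>.\<close>

lemma survival_between:
  fixes \<epsilon> bl bh :: real
  assumes n4: "n \<ge> 4" and B: "B \<subseteq> hypercube n" and t: "real t \<ge> real n * ln (real n)" and r: "r \<ge> 1"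
    and \<epsilon>: "0 \<le> \<epsilon>" "\<epsilon> \<le> 1"
    and hits: "\<And>x. x \<in> hypercube n \<Longrightarrow> mean_hits n (\<lambda>_. B) (t + 2 * r) x \<le> \<epsilon>"
    and b: "bl \<le> real (card B) / 2 ^ n" "real (card B) / 2 ^ n \<le> bh"
    and v: "v = 2 * real r * bh * (1 + 4 / real n)" "v \<le> 1 / 2"
    and q: "q = N div (t + 2 * r)" and x: "x \<in> hypercube n"
  shows "survival n (\<lambda>_. B) N x \<le> exp (- (real q * ((1 - \<epsilon>) * (2 * real r * bl * (1 - 4 / real n)))))"
    and "exp (- (real (Suc q) * (v + 2 * v\<^sup>2))) -
      (\<epsilon> + real (Suc q) * real t * (2 * bh * (1 + 4 / real n))) \<le> survival n (\<lambda>_. B) N x"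
proof -
  interpret block_walk n t r B \<epsilon>
    using n4 B t r \<epsilon> hits by unfold_locales auto
  have d: "0 \<le> 1 - d" using n4 by (simp add: d_def)
  have b': "bl \<le> b" "b \<le> bh" using b by (simp_all add: b_def)
  have L: "L > 0" "L = t + 2 * r" using r by (auto simp: L_def)
  have "survival n (\<lambda>_. B) N x \<le> survival n (\<lambda>_. B) (q * L) x"
    using n x L q by (intro survival_antimono_time) auto
  also have "\<dots> \<le> (1 - (1 - \<epsilon>) * (2 * real r * b * (1 - d))) ^ q" by (rule survival_blocks_le[OF x])
  also have "\<dots> \<le> exp (- ((1 - \<epsilon>) * (2 * real r * b * (1 - d)))) ^ q"
  proof (rule power_mono)
    show "1 - (1 - \<epsilon>) * (2 * real r * b * (1 - d)) \<le> exp (- ((1 - \<epsilon>) * (2 * real r * b * (1 - d))))"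
      using exp_ge_add_one_self[of "- ((1 - \<epsilon>) * (2 * real r * b * (1 - d)))"] by simp
    show "0 \<le> 1 - (1 - \<epsilon>) * (2 * real r * b * (1 - d))"
      using survival_block_le[OF x] survival_nonneg[OF x, of D L] by linarith
  qed
  also have "\<dots> = exp (- (real q * ((1 - \<epsilon>) * (2 * real r * b * (1 - d)))))"
    by (simp add: exp_of_nat_mult[symmetric])
  also have "\<dots> \<le> exp (- (real q * ((1 - \<epsilon>) * (2 * real r * bl * (1 - d)))))"
    using b' d \<epsilon> by (simp add: mult_left_mono mult_right_mono)
  finally show "survival n (\<lambda>_. B) N x \<le> exp (- (real q * ((1 - \<epsilon>) * (2 * real r * bl * (1 - 4 / real n)))))"
    by (simp add: d_def)
next
  interpret block_walk n t r B \<epsilon>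
    using n4 B t r \<epsilon> hits by unfold_locales auto
  have b': "b \<le> bh" using b by (simp add: b_def)
  have L: "L > 0" "L = t + 2 * r" using r by (auto simp: L_def)
  have u: "2 * real r * b * (1 + d) \<le> v" "0 \<le> 2 * real r * b * (1 + d)"
    unfolding v(1) using b' b_nonneg d_nonneg by (auto simp: d_def intro!: mult_right_mono mult_left_mono)
  have v0: "0 \<le> v" using u by linarith
  have "exp (- v - 2 * v\<^sup>2) \<le> exp (ln (1 - v))"
    using ln_one_minus_pos_lower_bound[OF v0 v(2)] by simp
  then have "exp (- v - 2 * v\<^sup>2) ^ Suc q \<le> (1 - 2 * real r * b * (1 + d)) ^ Suc q"
    using u v by (intro power_mono) auto
  moreover have "exp (- v - 2 * v\<^sup>2) ^ Suc q = exp (- (real (Suc q) * (v + 2 * v\<^sup>2)))"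
    unfolding exp_of_nat_mult[symmetric] by (simp add: algebra_simps)
  moreover have "real (Suc q) * real t * (2 * b * (1 + d)) \<le> real (Suc q) * real t * (2 * bh * (1 + d))"
    using b' d_nonneg by (intro mult_left_mono mult_right_mono) auto
  ultimately have "exp (- (real (Suc q) * (v + 2 * v\<^sup>2))) -
      (\<epsilon> + real (Suc q) * real t * (2 * bh * (1 + d))) \<le>
      (1 - 2 * real r * b * (1 + d)) ^ Suc q - (\<epsilon> + real (Suc q) * real t * (2 * b * (1 + d)))"
    by linarith
  also have "\<dots> \<le> survival n (\<lambda>_. B) (Suc q * L) x"
    using u v by (intro survival_blocks_ge x) auto
  also have "\<dots> \<le> survival n (\<lambda>_. B) N x"
  proof -
    have "N < Suc q * L" using L q by (metis dividend_less_div_times mult.commute mult_Suc add.commute)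
    then show ?thesis using n x by (intro survival_antimono_time) auto
  qed
  finally show "exp (- (real (Suc q) * (v + 2 * v\<^sup>2))) -
      (\<epsilon> + real (Suc q) * real t * (2 * bh * (1 + 4 / real n))) \<le> survival n (\<lambda>_. B) N x"
    by (simp add: d_def)
qed

text \<open>The error does not depend on the set, only on its density and on \<open>\<epsilon>\<close>. This uniformity is
needed because the set \<open>A n - {x}\<close> changes with the starting point.\<close>

lemma survival_tendsto:
  fixes t r :: "nat \<Rightarrow> nat" and m bl bh \<epsilon> :: "nat \<Rightarrow> real" and a :: real
  assumes a: "a > 0" and m: "filterlim m at_top sequentially"
    and t: "\<And>n. real (t n) \<ge> real n * ln (real n)" and r: "eventually (\<lambda>n. r n \<ge> 1) sequentially"
    and tr: "(\<lambda>n. real (t n) / real (r n)) \<longlonglongrightarrow> 0" and rm: "(\<lambda>n. real (r n) / m n) \<longlonglongrightarrow> 0"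
    and bl: "(\<lambda>n. m n * bl n) \<longlonglongrightarrow> 1" and bh: "(\<lambda>n. m n * bh n) \<longlonglongrightarrow> 1"
    and \<epsilon>: "\<epsilon> \<longlonglongrightarrow> 0"
  obtains err :: "nat \<Rightarrow> real" where "err \<longlonglongrightarrow> 0"
    "eventually (\<lambda>n. \<forall>B\<subseteq>hypercube n. bl n \<le> real (card B) / 2 ^ n \<longrightarrow> real (card B) / 2 ^ n \<le> bh n \<longrightarrow>
      (\<forall>x\<in>hypercube n. mean_hits n (\<lambda>_. B) (t n + 2 * r n) x \<le> \<epsilon> n) \<longrightarrow>
      (\<forall>x\<in>hypercube n. \<bar>survival n (\<lambda>_. B) (nat \<lceil>a * m n\<rceil> - 1) x - exp (- a)\<bar> \<le> err n)) sequentially"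
proof -
  define L where "L n = t n + 2 * r n" for n
  define N where "N n = nat \<lceil>a * m n\<rceil> - 1" for n
  define q where "q n = N n div L n" for n
  define v where "v n = 2 * real (r n) * bh n * (1 + 4 / real n)" for n
  define hi where "hi n = exp (- (real (q n) * ((1 - \<epsilon> n) * (2 * real (r n) * bl n * (1 - 4 / real n)))))" for n
  define lo where "lo n = exp (- (real (Suc (q n)) * (v n + 2 * (v n)\<^sup>2))) -
      (\<epsilon> n + real (Suc (q n)) * real (t n) * (2 * bh n * (1 + 4 / real n)))" for n
  have m_pos: "eventually (\<lambda>n. m n > 0) sequentially" using m by (simp add: filterlim_at_top_dense)
  have d: "(\<lambda>n. 4 / real n) \<longlonglongrightarrow> 0" by real_asymp
  have inv_m: "(\<lambda>n. 1 / m n) \<longlonglongrightarrow> 0" using m by (simp add: tendsto_divide_0[OF tendsto_const] filterlim_at_top_imp_at_infinity)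
  have tm: "(\<lambda>n. real (t n) / m n) \<longlonglongrightarrow> 0"
  proof (rule Lim_transform_eventually)
    show "(\<lambda>n. real (t n) / real (r n) * (real (r n) / m n)) \<longlonglongrightarrow> 0"
      using tendsto_mult[OF tr rm] by simp
    show "eventually (\<lambda>n. real (t n) / real (r n) * (real (r n) / m n) = real (t n) / m n) sequentially"
      using r by eventually_elim simp
  qed
  have Lm: "(\<lambda>n. real (L n) / m n) \<longlonglongrightarrow> 0"
    using tendsto_add[OF tm tendsto_mult[OF tendsto_const[of 2] rm]]
    by (simp add: L_def add_divide_distrib)
  have qL: "(\<lambda>n. real (q n) * real (L n) / m n) \<longlonglongrightarrow> a"
  proof (rule tendsto_sandwich)
    show "(\<lambda>n. a - 2 * (1 / m n) - real (L n) / m n) \<longlonglongrightarrow> a"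
      using tendsto_diff[OF tendsto_diff[OF tendsto_const[of a] tendsto_mult[OF tendsto_const[of 2] inv_m]] Lm] by simp
    show "(\<lambda>_. a) \<longlonglongrightarrow> a" by simp
    show "eventually (\<lambda>n. a - 2 * (1 / m n) - real (L n) / m n \<le> real (q n) * real (L n) / m n) sequentially"
      using m_pos r
    proof eventually_elim
      case (elim n)
      have am: "a * m n > 0" using a elim by simp
      have L: "L n > 0" using elim by (simp add: L_def)
      have "N n = q n * L n + N n mod L n" by (simp add: q_def)
      also have "N n mod L n < L n" using L by simp
      finally have "real (N n) \<le> real (q n) * real (L n) + real (L n)"
        by (simp flip: of_nat_mult of_nat_add)
      moreover have "a * m n - 2 \<le> real (N n)" using am unfolding N_def by linarith
      ultimately have "(a * m n - 2 - real (L n)) / m n \<le> real (q n) * real (L n) / m n"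
        using elim by (intro divide_right_mono) auto
      then show ?case using elim by (simp add: diff_divide_distrib)
    qed
    show "eventually (\<lambda>n. real (q n) * real (L n) / m n \<le> a) sequentially"
      using m_pos
    proof eventually_elim
      case (elim n)
      have am: "a * m n > 0" using a elim by simp
      have "q n * L n \<le> N n" by (simp add: q_def)
      then have "real (q n) * real (L n) \<le> real (N n)" by (simp flip: of_nat_mult)
      also have "\<dots> \<le> a * m n" using am unfolding N_def by linarith
      finally show ?case using elim by (simp add: field_simps)
    qed
  qed
  have rL: "(\<lambda>n. 2 * real (r n) / real (L n)) \<longlonglongrightarrow> 1"
  proof (rule Lim_transform_eventually)
    show "(\<lambda>n. 2 / (real (t n) / real (r n) + 2)) \<longlonglongrightarrow> 1"
      using tendsto_divide[OF tendsto_const[of 2] tendsto_add[OF tr tendsto_const[of 2]]] by simp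
    show "eventually (\<lambda>n. 2 / (real (t n) / real (r n) + 2) = 2 * real (r n) / real (L n)) sequentially"
      using r by eventually_elim (simp add: L_def field_simps)
  qed
  have qr: "(\<lambda>n. real (q n) * (2 * real (r n)) / m n) \<longlonglongrightarrow> a"
  proof (rule Lim_transform_eventually)
    show "(\<lambda>n. real (q n) * real (L n) / m n * (2 * real (r n) / real (L n))) \<longlonglongrightarrow> a"
      using tendsto_mult[OF qL rL] by simp
    show "eventually (\<lambda>n. real (q n) * real (L n) / m n * (2 * real (r n) / real (L n)) =
        real (q n) * (2 * real (r n)) / m n) sequentially"
      using r by eventually_elim (simp add: L_def)
  qed
  have qt: "(\<lambda>n. real (q n) * real (t n) / m n) \<longlonglongrightarrow> 0"
  proof (rule Lim_transform_eventually)
    show "(\<lambda>n. real (q n) * (2 * real (r n)) / m n * (real (t n) / real (r n) / 2)) \<longlonglongrightarrow> 0"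
      using tendsto_mult[OF qr tendsto_divide[OF tr tendsto_const[of 2]]] by simp
    show "eventually (\<lambda>n. real (q n) * (2 * real (r n)) / m n * (real (t n) / real (r n) / 2) =
        real (q n) * real (t n) / m n) sequentially"
      using r by eventually_elim simp
  qed
  have vlim: "v \<longlonglongrightarrow> 0"
  proof (rule Lim_transform_eventually)
    show "(\<lambda>n. 2 * (real (r n) / m n) * (m n * bh n) * (1 + 4 / real n)) \<longlonglongrightarrow> 0"
      using tendsto_mult[OF tendsto_mult[OF tendsto_mult[OF tendsto_const[of 2] rm] bh]
        tendsto_add[OF tendsto_const[of 1] d]] by simp
    show "eventually (\<lambda>n. 2 * (real (r n) / m n) * (m n * bh n) * (1 + 4 / real n) = v n) sequentially"
      using m_pos by eventually_elim (simp add: v_def)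
  qed
  have qv: "(\<lambda>n. real (Suc (q n)) * v n) \<longlonglongrightarrow> a"
  proof (rule Lim_transform_eventually)
    show "(\<lambda>n. real (q n) * (2 * real (r n)) / m n * (m n * bh n) * (1 + 4 / real n) + v n) \<longlonglongrightarrow> a"
      using tendsto_add[OF tendsto_mult[OF tendsto_mult[OF qr bh] tendsto_add[OF tendsto_const[of 1] d]] vlim] by simp
    show "eventually (\<lambda>n. real (q n) * (2 * real (r n)) / m n * (m n * bh n) * (1 + 4 / real n) + v n =
        real (Suc (q n)) * v n) sequentially"
      using m_pos by eventually_elim (simp add: v_def algebra_simps add_divide_distrib)
  qed
  have hi_lim: "hi \<longlonglongrightarrow> exp (- a)"
  proof -
    have "(\<lambda>n. real (q n) * ((1 - \<epsilon> n) * (2 * real (r n) * bl n * (1 - 4 / real n)))) \<longlonglongrightarrow> a"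
    proof (rule Lim_transform_eventually)
      show "(\<lambda>n. real (q n) * (2 * real (r n)) / m n * (m n * bl n) * (1 - \<epsilon> n) * (1 - 4 / real n)) \<longlonglongrightarrow> a"
        using tendsto_mult[OF tendsto_mult[OF tendsto_mult[OF qr bl] tendsto_diff[OF tendsto_const[of 1] \<epsilon>]]
          tendsto_diff[OF tendsto_const[of 1] d]] by simp
      show "eventually (\<lambda>n. real (q n) * (2 * real (r n)) / m n * (m n * bl n) * (1 - \<epsilon> n) * (1 - 4 / real n) =
          real (q n) * ((1 - \<epsilon> n) * (2 * real (r n) * bl n * (1 - 4 / real n)))) sequentially"
        using m_pos by eventually_elim simp
    qed
    then show ?thesis unfolding hi_def by (intro tendsto_exp tendsto_minus)
  qed
  have lo_lim: "lo \<longlonglongrightarrow> exp (- a)"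
  proof -
    have "(\<lambda>n. real (Suc (q n)) * v n * (1 + 2 * v n)) \<longlonglongrightarrow> a * (1 + 2 * 0)"
      by (intro tendsto_intros qv vlim)
    then have 1: "(\<lambda>n. real (Suc (q n)) * (v n + 2 * (v n)\<^sup>2)) \<longlonglongrightarrow> a"
      by (simp add: algebra_simps power2_eq_square)
    have 2: "(\<lambda>n. real (Suc (q n)) * real (t n) * (2 * bh n * (1 + 4 / real n))) \<longlonglongrightarrow> 0"
    proof (rule Lim_transform_eventually)
      show "(\<lambda>n. (real (q n) * real (t n) / m n + real (t n) / m n) * 2 * (m n * bh n) * (1 + 4 / real n)) \<longlonglongrightarrow> 0"
        using tendsto_mult[OF tendsto_mult[OF tendsto_mult[OF tendsto_add[OF qt tm] tendsto_const[of 2]] bh]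
          tendsto_add[OF tendsto_const[of 1] d]] by simp
      show "eventually (\<lambda>n. (real (q n) * real (t n) / m n + real (t n) / m n) * 2 * (m n * bh n) * (1 + 4 / real n) =
          real (Suc (q n)) * real (t n) * (2 * bh n * (1 + 4 / real n))) sequentially"
        using m_pos by eventually_elim (simp add: algebra_simps add_divide_distrib)
    qed
    show ?thesis
      using tendsto_diff[OF tendsto_exp[OF tendsto_minus[OF 1]] tendsto_add[OF \<epsilon> 2]]
      unfolding lo_def by simp
  qed
  show ?thesis
  proof (rule that)
    show "(\<lambda>n. \<bar>lo n - exp (- a)\<bar> + \<bar>hi n - exp (- a)\<bar>) \<longlonglongrightarrow> 0"
      using tendsto_add[OF tendsto_rabs[OF tendsto_diff[OF lo_lim tendsto_const[of "exp (- a)"]]]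
        tendsto_rabs[OF tendsto_diff[OF hi_lim tendsto_const[of "exp (- a)"]]]] by simp
    have "eventually (\<lambda>n. \<epsilon> n < 1) sequentially" by (rule order_tendstoD(2)[OF \<epsilon>]) simp
    moreover have "eventually (\<lambda>n. v n < 1 / 2) sequentially" by (rule order_tendstoD(2)[OF vlim]) simp
    ultimately show "eventually (\<lambda>n. \<forall>B\<subseteq>hypercube n. bl n \<le> real (card B) / 2 ^ n \<longrightarrow>
      real (card B) / 2 ^ n \<le> bh n \<longrightarrow>
      (\<forall>x\<in>hypercube n. mean_hits n (\<lambda>_. B) (t n + 2 * r n) x \<le> \<epsilon> n) \<longrightarrow>
      (\<forall>x\<in>hypercube n. \<bar>survival n (\<lambda>_. B) (nat \<lceil>a * m n\<rceil> - 1) x - exp (- a)\<bar>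
        \<le> \<bar>lo n - exp (- a)\<bar> + \<bar>hi n - exp (- a)\<bar>)) sequentially"
      using r eventually_ge_at_top[of 4]
    proof (eventually_elim, intro allI impI ballI)
      fix n B x
      assume n: "\<epsilon> n < 1" "v n < 1 / 2" "1 \<le> r n" "4 \<le> n" and B: "B \<subseteq> hypercube n"
        "bl n \<le> real (card B) / 2 ^ n" "real (card B) / 2 ^ n \<le> bh n"
        and hits: "\<forall>x\<in>hypercube n. mean_hits n (\<lambda>_. B) (t n + 2 * r n) x \<le> \<epsilon> n"
        and x: "x \<in> hypercube n"
      have "0 \<le> \<epsilon> n" using hits x mean_hits_nonneg[OF x, of "\<lambda>_. B" "t n + 2 * r n"] by force
      then have "survival n (\<lambda>_. B) (N n) x \<le> hi n" "lo n \<le> survival n (\<lambda>_. B) (N n) x"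
        using survival_between[of n B "t n" "r n" "\<epsilon> n" "bl n" "bh n" "v n" "q n" "N n" x]
          n B hits x t by (auto simp: hi_def lo_def q_def L_def v_def)
      then show "\<bar>survival n (\<lambda>_. B) (nat \<lceil>a * m n\<rceil> - 1) x - exp (- a)\<bar>
        \<le> \<bar>lo n - exp (- a)\<bar> + \<bar>hi n - exp (- a)\<bar>" unfolding N_def by linarith
    qed
  qed
qed

lemma Max_abs_tendsto_zero:
  fixes f :: "nat \<Rightarrow> vertex \<Rightarrow> real"
  assumes "err \<longlonglongrightarrow> 0"
    and "eventually (\<lambda>n. S n \<subseteq> hypercube n \<and> S n \<noteq> {} \<and> (\<forall>x\<in>S n. \<bar>f n x\<bar> \<le> err n)) sequentially"
  shows "(\<lambda>n. MAX x\<in>S n. \<bar>f n x\<bar>) \<longlonglongrightarrow> 0"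
proof (rule tendsto_sandwich[OF _ _ tendsto_const assms(1)])
  have fin: "finite (S n)" if "S n \<subseteq> hypercube n" for n
    using that finite_hypercube by (rule finite_subset)
  show "eventually (\<lambda>n. (MAX x\<in>S n. \<bar>f n x\<bar>) \<le> err n) sequentially"
    using assms(2) by eventually_elim (auto simp: fin)
  show "eventually (\<lambda>n. 0 \<le> (MAX x\<in>S n. \<bar>f n x\<bar>)) sequentially"
    using assms(2) by eventually_elim (auto simp: fin Max_ge_iff)
qed

theorem theorem1p2:
  fixes M :: "nat \<Rightarrow> nat" and m :: "nat \<Rightarrow> real"
    and P' :: "'o measure" and A :: "nat \<Rightarrow> 'o \<Rightarrow> vertex set"
    and P :: "nat \<Rightarrow> vertex \<Rightarrow> 'w measure" and Y :: "nat \<Rightarrow> nat \<Rightarrow> 'w \<Rightarrow> vertex"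
  assumes m_def: "\<And>n. n \<ge> 1 \<Longrightarrow> m n = 2 ^ n / real (M n)"
    and M_pos: "\<And>n. n \<ge> 1 \<Longrightarrow> M n > 0"
    and m_lower: "(\<lambda>n. real n * ln (real n) / m n) \<longlonglongrightarrow> 0"
    and m_upper: "\<And>n. n \<ge> 1 \<Longrightarrow> m n \<le> 2 ^ n"
    and P': "prob_space P'"
    and A_measurable: "\<And>n. n \<ge> 1 \<Longrightarrow>
      A n \<in> measurable P' (count_space (k_subsets (hypercube n) (M n)))"
    and A_uniform: "\<And>n. n \<ge> 1 \<Longrightarrow>
      distr P' (count_space (k_subsets (hypercube n) (M n))) (A n) =
      uniform_count_measure (k_subsets (hypercube n) (M n))"
    and Y: "\<And>n x. n \<ge> 1 \<Longrightarrow> x \<in> hypercube n \<Longrightarrow> simple_random_walk n x (P n x) (Y n)"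
  shows "\<forall>a>0.
    (filterlim M at_top sequentially \<longrightarrow>
      (AE \<omega> in P'. (\<lambda>n. MAX x\<in>hypercube n.
        \<bar>\<P>(w in P n x. ereal_of_enat (hitting_time (A n \<omega> - {x}) (\<lambda>k. Y n k w)) \<ge> ereal (a * m n))
          - exp (- a)\<bar>) \<longlonglongrightarrow> 0)) \<and>
    (AE \<omega> in P'. (\<lambda>n. MAX x\<in>hypercube n - A n \<omega>.
      \<bar>\<P>(w in P n x. ereal_of_enat (hitting_time (A n \<omega> - {x}) (\<lambda>k. Y n k w)) \<ge> ereal (a * m n))
        - exp (- a)\<bar>) \<longlonglongrightarrow> 0)"
proof (intro allI impI)
  fix a :: real assume a: "a > 0"
  let ?p = "\<lambda>\<omega> n x. \<P>(w in P n x. ereal_of_enat (hitting_time (A n \<omega> - {x}) (\<lambda>k. Y n k w)) \<ge> ereal (a * m n))"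
  have m_pos: "m n > 0" if "n \<ge> 1" for n using m_def[OF that] M_pos[OF that] by simp
  have m_top: "filterlim m at_top sequentially"
  proof (rule filterlim_at_top_mono)
    show "filterlim (\<lambda>n. real n * ln (real n)) at_top sequentially" by real_asymp
    show "eventually (\<lambda>n. real n * ln (real n) \<le> m n) sequentially"
      using order_tendstoD(2)[OF m_lower zero_less_one] eventually_ge_at_top[of 1]
      by eventually_elim (use m_pos in \<open>auto simp: field_simps\<close>)
  qed
  obtain t r :: "nat \<Rightarrow> nat" where t: "\<And>n. real (t n) \<ge> real n * ln (real n)"
    and r: "eventually (\<lambda>n. r n \<ge> 1) sequentially"
    and L: "eventually (\<lambda>n. t n + 2 * r n \<le> 3 * n\<^sup>2) sequentially"
    and tr: "(\<lambda>n. real (t n) / real (r n)) \<longlonglongrightarrow> 0" and rm: "(\<lambda>n. real (r n) / m n) \<longlonglongrightarrow> 0"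
    using exists_block_lengths[OF m_pos m_lower] by blast
  let ?L = "\<lambda>n. t n + 2 * r n"
  have LM: "(\<lambda>n. real (?L n) * real (M n) / 2 ^ n) \<longlonglongrightarrow> 0"
  proof (rule Lim_transform_eventually)
    show "(\<lambda>n. real (t n) / real (r n) * (real (r n) / m n) + 2 * (real (r n) / m n)) \<longlonglongrightarrow> 0"
      using tendsto_add[OF tendsto_mult[OF tr rm] tendsto_mult[OF tendsto_const[of 2] rm]] by simp
    show "eventually (\<lambda>n. real (t n) / real (r n) * (real (r n) / m n) + 2 * (real (r n) / m n) =
        real (?L n) * real (M n) / 2 ^ n) sequentially"
      using r eventually_ge_at_top[of 1]
      by eventually_elim (use M_pos in \<open>simp add: m_def field_simps\<close>)
  qed
  define good where "good \<omega> \<longleftrightarrow> (\<forall>\<epsilon>>0. \<forall>\<^sub>F n in sequentially.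
    \<forall>x\<in>hypercube n. mean_hits n (\<lambda>_. A n \<omega>) (?L n) x \<le> \<epsilon>)" for \<omega>
  have AE_good: "AE \<omega> in P'. good \<omega>"
    unfolding good_def by (rule AE_mean_hits_small[OF P' A_measurable A_uniform L LM])
  have A: "A n \<omega> \<subseteq> hypercube n" "card (A n \<omega>) = M n" if "\<omega> \<in> space P'" "n \<ge> 1" for n \<omega>
    using measurable_space[OF A_measurable[OF that(2)] that(1)] by (auto simp: k_subsets_def)
  \<comment> \<open>Both claims follow from this one. They differ in the set of starting points and in the
    lower bound for the density of \<open>A n - {x}\<close>, which loses a point if \<open>x \<in> A n\<close>.\<close>
  have conv: "(\<lambda>n. MAX x\<in>S n. \<bar>?p \<omega> n x - exp (- a)\<bar>) \<longlonglongrightarrow> 0"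
    if \<omega>: "\<omega> \<in> space P'" "good \<omega>"
      and bl: "(\<lambda>n. m n * bl n) \<longlonglongrightarrow> 1" and bh: "(\<lambda>n. m n * bh n) \<longlonglongrightarrow> 1"
      and S: "eventually (\<lambda>n. S n \<subseteq> hypercube n \<and> S n \<noteq> {}) sequentially"
      and density: "\<And>n x. n \<ge> 1 \<Longrightarrow> x \<in> S n \<Longrightarrow> bl n \<le> real (card (A n \<omega> - {x})) / 2 ^ n \<and>
        real (card (A n \<omega> - {x})) / 2 ^ n \<le> bh n"
    for \<omega> S and bl bh :: "nat \<Rightarrow> real"
  proof -
    define \<epsilon> where "\<epsilon> n = (MAX x\<in>hypercube n. \<bar>mean_hits n (\<lambda>_. A n \<omega>) (?L n) x\<bar>)" for n
    have ne: "hypercube n \<noteq> {}" for n using card_hypercube[of n] by auto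
    have \<epsilon>: "\<epsilon> \<longlonglongrightarrow> 0"
    proof (rule tendstoI)
      fix e :: real assume "e > 0"
      then have "\<forall>\<^sub>F n in sequentially. \<forall>x\<in>hypercube n. mean_hits n (\<lambda>_. A n \<omega>) (?L n) x \<le> e / 2"
        using \<omega>(2) half_gt_zero unfolding good_def by blast
      then show "\<forall>\<^sub>F n in sequentially. dist (\<epsilon> n) 0 < e"
      proof eventually_elim
        case (elim n)
        then have "\<epsilon> n \<le> e / 2"
          unfolding \<epsilon>_def using mean_hits_nonneg by (subst Max_le_iff) (auto simp: ne)
        moreover have "0 \<le> \<epsilon> n" unfolding \<epsilon>_def by (subst Max_ge_iff) (use ne in auto)
        ultimately show ?case using \<open>e > 0\<close> by simp
      qed
    qed
    obtain err where err: "err \<longlonglongrightarrow> 0"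
      "eventually (\<lambda>n. \<forall>B\<subseteq>hypercube n. bl n \<le> real (card B) / 2 ^ n \<longrightarrow> real (card B) / 2 ^ n \<le> bh n \<longrightarrow>
      (\<forall>x\<in>hypercube n. mean_hits n (\<lambda>_. B) (?L n) x \<le> \<epsilon> n) \<longrightarrow>
      (\<forall>x\<in>hypercube n. \<bar>survival n (\<lambda>_. B) (nat \<lceil>a * m n\<rceil> - 1) x - exp (- a)\<bar> \<le> err n)) sequentially"
      using survival_tendsto[OF a m_top t r tr rm bl bh \<epsilon>] by blast
    show ?thesis
    proof (rule Max_abs_tendsto_zero[OF err(1)])
      show "eventually (\<lambda>n. S n \<subseteq> hypercube n \<and> S n \<noteq> {} \<and>
          (\<forall>x\<in>S n. \<bar>?p \<omega> n x - exp (- a)\<bar> \<le> err n)) sequentially"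
        using S err(2) eventually_ge_at_top[of 1]
      proof (eventually_elim, intro conjI ballI)
        fix n x
        assume S: "S n \<subseteq> hypercube n \<and> S n \<noteq> {}" and n: "1 \<le> n" and xS: "x \<in> S n"
          and bound: "\<forall>B\<subseteq>hypercube n. bl n \<le> real (card B) / 2 ^ n \<longrightarrow> real (card B) / 2 ^ n \<le> bh n \<longrightarrow>
            (\<forall>x\<in>hypercube n. mean_hits n (\<lambda>_. B) (?L n) x \<le> \<epsilon> n) \<longrightarrow>
            (\<forall>x\<in>hypercube n. \<bar>survival n (\<lambda>_. B) (nat \<lceil>a * m n\<rceil> - 1) x - exp (- a)\<bar> \<le> err n)"
        have x: "x \<in> hypercube n" using S xS by auto
        interpret random_walk "P n x" n x "Y n"
          using Y[OF n x] n x by (auto simp: random_walk_def random_walk_axioms_def simple_random_walk_def)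
        have sub: "A n \<omega> - {x} \<subseteq> hypercube n" using A[OF \<omega>(1) n] by auto
        have "mean_hits n (\<lambda>_. A n \<omega> - {x}) (?L n) y \<le> \<epsilon> n" if y: "y \<in> hypercube n" for y
        proof -
          have "mean_hits n (\<lambda>_. A n \<omega> - {x}) (?L n) y \<le> mean_hits n (\<lambda>_. A n \<omega>) (?L n) y"
            using A[OF \<omega>(1) n] by (intro mean_hits_mono y) auto
          also have "\<dots> \<le> \<bar>mean_hits n (\<lambda>_. A n \<omega>) (?L n) y\<bar>" by simp
          also have "\<dots> \<le> \<epsilon> n" unfolding \<epsilon>_def using y by (intro Max_ge) auto
          finally show ?thesis .
        qed
        then have "\<bar>survival n (\<lambda>_. A n \<omega> - {x}) (nat \<lceil>a * m n\<rceil> - 1) x - exp (- a)\<bar> \<le> err n"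
          using bound sub density[OF n xS] x by blast
        then show "\<bar>?p \<omega> n x - exp (- a)\<bar> \<le> err n"
          by (subst prob_hitting_time_ge) auto
      qed auto
    qed
  qed
  have density: "(\<lambda>n. m n * (real (M n) / 2 ^ n)) \<longlonglongrightarrow> 1"
    by (rule Lim_transform_eventually[OF tendsto_const], use eventually_ge_at_top[of 1] in eventually_elim)
      (use M_pos in \<open>simp add: m_def\<close>)
  show "(filterlim M at_top sequentially \<longrightarrow>
      (AE \<omega> in P'. (\<lambda>n. MAX x\<in>hypercube n. \<bar>?p \<omega> n x - exp (- a)\<bar>) \<longlonglongrightarrow> 0)) \<and>
    (AE \<omega> in P'. (\<lambda>n. MAX x\<in>hypercube n - A n \<omega>. \<bar>?p \<omega> n x - exp (- a)\<bar>) \<longlonglongrightarrow> 0)"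
  proof (intro conjI impI)
    assume M_top: "filterlim M at_top sequentially"
    \<comment> \<open>The removal of one point is negligible because \<open>M n\<close> tends to infinity.\<close>
    have density': "(\<lambda>n. m n * ((real (M n) - 1) / 2 ^ n)) \<longlonglongrightarrow> 1"
    proof (rule Lim_transform_eventually)
      have "filterlim (\<lambda>n. real (M n)) at_top sequentially"
        by (rule filterlim_compose[OF filterlim_real_sequentially M_top])
      then have "(\<lambda>n. 1 / real (M n)) \<longlonglongrightarrow> 0"
        by (simp add: tendsto_divide_0[OF tendsto_const] filterlim_at_top_imp_at_infinity)
      then show "(\<lambda>n. 1 - 1 / real (M n)) \<longlonglongrightarrow> 1"
        using tendsto_diff[OF tendsto_const[of 1]] by force
      show "eventually (\<lambda>n. 1 - 1 / real (M n) = m n * ((real (M n) - 1) / 2 ^ n)) sequentially"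
        using eventually_ge_at_top[of 1]
        by eventually_elim (use M_pos in \<open>simp add: m_def field_simps\<close>)
    qed
    show "AE \<omega> in P'. (\<lambda>n. MAX x\<in>hypercube n. \<bar>?p \<omega> n x - exp (- a)\<bar>) \<longlonglongrightarrow> 0"
      using AE_good AE_space
    proof eventually_elim
      case (elim \<omega>)
      show ?case
      proof (rule conv[OF elim(2,1) density' density])
        have "hypercube n \<noteq> {}" for n using card_hypercube[of n] by auto
        then show "eventually (\<lambda>n. hypercube n \<subseteq> hypercube n \<and> hypercube n \<noteq> {}) sequentially" by simp
        fix n x assume n: "(1::nat) \<le> n"
        have fin: "finite (A n \<omega>)" using A(1)[OF elim(2) n] finite_hypercube by (rule finite_subset)
        then have "card (A n \<omega> - {x}) \<le> M n" "M n \<le> card (A n \<omega> - {x}) + 1"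
          using A(2)[OF elim(2) n] card_Diff1_le[of "A n \<omega>" x] card_Diff_singleton_if[of "A n \<omega>" x] by auto
        then show "(real (M n) - 1) / 2 ^ n \<le> real (card (A n \<omega> - {x})) / 2 ^ n \<and>
          real (card (A n \<omega> - {x})) / 2 ^ n \<le> real (M n) / 2 ^ n"
          by (auto intro!: divide_right_mono)
      qed
    qed
  next
    show "AE \<omega> in P'. (\<lambda>n. MAX x\<in>hypercube n - A n \<omega>. \<bar>?p \<omega> n x - exp (- a)\<bar>) \<longlonglongrightarrow> 0"
      using AE_good AE_space
    proof eventually_elim
      case (elim \<omega>)
      show ?case
      proof (rule conv[OF elim(2,1) density density])
        \<comment> \<open>The maximum is over a nonempty set only if \<open>A n\<close> is not the whole cube.\<close>
        have "eventually (\<lambda>n. m n > 1) sequentially" using m_top by (simp add: filterlim_at_top_dense)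
        then show "eventually (\<lambda>n. hypercube n - A n \<omega> \<subseteq> hypercube n \<and> hypercube n - A n \<omega> \<noteq> {}) sequentially"
          using eventually_ge_at_top[of 1]
        proof (eventually_elim, intro conjI)
          fix n assume n: "m n > 1" "1 \<le> n"
          then have "real (M n) < 2 ^ n" using M_pos by (simp add: m_def field_simps)
          then have "real (M n) < real (2 ^ n)" by simp
          then have "M n < 2 ^ n" by (simp only: of_nat_less_iff)
          then have "A n \<omega> \<noteq> hypercube n" using A(2)[OF elim(2) n(2)] by (auto simp: card_hypercube)
          then show "hypercube n - A n \<omega> \<noteq> {}" using A(1)[OF elim(2) n(2)] by auto
        qed auto
        fix n x assume "(1::nat) \<le> n" "x \<in> hypercube n - A n \<omega>"
        then show "real (M n) / 2 ^ n \<le> real (card (A n \<omega> - {x})) / 2 ^ n \<and>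
          real (card (A n \<omega> - {x})) / 2 ^ n \<le> real (M n) / 2 ^ n"
          using A(2)[OF elim(2)] by simp
      qed
    qed
  qed
qed

end
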